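(* Fix $\gamma>1/2$ and $z\in\mathbb{C}$. With $\Sigma_N(z)$, $G_N$, $N^*=N^*(z,\gamma,\varepsilon_N)$ and $B_N(z)$ as defined in the context, suppose that $N^*\log N/N\to\alpha<\infty$ as $N\to\infty$. Then for any sequence $\{\varepsilon_N\}$ that tends to $0$ slowly enough that $\log(\varepsilon_N^{-1})/\log N\to0$, $$\frac1N\log\left|\det\left(\Sigma_N(z)+N^{-\gamma}G_N\right)\right|-\frac1N\log\left|\det\left(B_N(z)\right)\right|\to-\alpha\left(\gamma-\tfrac12\right)$$ in probability, as $N\to\infty$. If $\alpha=0$, we may take $\varepsilon_N=N^{-\eta}$ for any $\eta>0$.
   Context: $\{M_N\}$ is a sequence of deterministic $N\times N$ complex matrices, and $G_N$ is an $N\times N$ matrix with i.i.d. standard complex Gaussian entries. Let $M_N(z):=M_N-z\,\mathrm{Id}$ and let $\Sigma_N(z)$ be the $N\times N$ diagonal matrix of the singular values of $M_N(z)$, with diagonal entries $\Sigma_{11}(z)\le\Sigma_{22}(z)\le\dots\le\Sigma_{NN}(z)$ in non-decreasing order. For a positive sequence $\{\varepsilon_N\}$ tending to $0$, $N^*=N^*(z,\gamma,\varepsilon_N)$ is the largest integer $i\in\{1,\dots,N\}$ such that $$\Sigma_{ii}(z)<\varepsilon_N^{-1}N^{-\gamma}(N-i+1)^{1/2},$$ and $N^*:=1$ if no such $i$ exists. $B_N(z)$ is the $(N-N^* )\times(N-N^* )$ lower-right block of $\Sigma_N(z)$, i.e. the diagonal matrix with entries $\Sigma_{ii}(z)$,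 $N^*<i\le N$. (Note that $|\det(\Sigma_N(z)+N^{-\gamma}G_N)|$ has the same law as $|\det(M_N+N^{-\gamma}G_N-z\,\mathrm{Id})|$.)
   Formalization: Added hypothesis: log⁺ Σ_11(z) / N → 0. Without it the claim fails (M_N = exp(N²) Id, z = 0: N*=1, α=0, but the difference grows like N); it restricts only those N where no index satisfies the inequality defining N*. *)

theory Defs
  imports
    "HOL-Probability.Probability"
    "Jordan_Normal_Form.Schur_Decomposition"
begin

text \<open>Singular values in non-decreasing order: the square roots of the eigenvalues of \<open>A\<^sup>* A\<close>,
  with algebraic multiplicity. These eigenvalues are real and non-negative, so \<open>Re\<close> loses nothing.\<close>

definition singular_values :: "complex mat \<Rightarrow> real list" where
  "singular_values A =
     sorted_list_of_multiset
       (image_mset (\<lambda>x. sqrt (Re x)) (proots (char_poly (mat_adjoint A * A))))"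

text \<open>For \<open>n \<times> n\<close> matrices; indices run over \<open>1, \<dots>, n\<close>, so \<open>sing_val A 1\<close> is the smallest.\<close>

definition sing_val :: "complex mat \<Rightarrow> nat \<Rightarrow> real" where
  "sing_val A i = singular_values A ! (i - 1)"

text \<open>Matrix entries are indexed from \<open>0\<close>.\<close>

definition Sigma_mat :: "complex mat \<Rightarrow> complex mat" where
  "Sigma_mat A = mat_diag (dim_row A) (\<lambda>i. complex_of_real (sing_val A (i + 1)))"

definition N_star :: "real \<Rightarrow> real \<Rightarrow> complex mat \<Rightarrow> nat" where
  "N_star \<gamma> \<epsilon> A =
     (let n = dim_row A;
          I = {i \<in> {1..n}.
                 sing_val A i < inverse \<epsilon> * real n powr (- \<gamma>) * sqrt (real n - real i + 1)}
      in if I = {} then 1 else Max I)"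

definition lower_right_block :: "nat \<Rightarrow> 'a mat \<Rightarrow> 'a mat" where
  "lower_right_block k A =
     Matrix.mat (dim_row A - k) (dim_col A - k) (\<lambda>(i, j). A $$ (k + i, k + j))"

definition B_mat :: "real \<Rightarrow> real \<Rightarrow> complex mat \<Rightarrow> complex mat" where
  "B_mat \<gamma> \<epsilon> A = lower_right_block (N_star \<gamma> \<epsilon> A) (Sigma_mat A)"

definition shifted :: "complex mat \<Rightarrow> complex \<Rightarrow> complex mat" where
  "shifted A z = A - z \<cdot>\<^sub>m 1\<^sub>m (dim_row A)"

text \<open>Normalised to \<open>E X = 0\<close>, \<open>E \<bar>X\<bar>\<^sup>2 = 1\<close>, \<open>E X\<^sup>2 = 0\<close>: real and imaginary part
  are independent real Gaussians of variance \<open>1/2\<close>.\<close>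

definition std_complex_gaussian :: "'a measure \<Rightarrow> ('a \<Rightarrow> complex) \<Rightarrow> bool" where
  "std_complex_gaussian P X \<longleftrightarrow>
     prob_space.indep_var P borel (\<lambda>\<omega>. Re (X \<omega>)) borel (\<lambda>\<omega>. Im (X \<omega>)) \<and>
     distributed P lborel (\<lambda>\<omega>. Re (X \<omega>)) (normal_density 0 (sqrt (1/2))) \<and>
     distributed P lborel (\<lambda>\<omega>. Im (X \<omega>)) (normal_density 0 (sqrt (1/2)))"

definition iid_gaussian_matrix :: "'a measure \<Rightarrow> nat \<Rightarrow> ('a \<Rightarrow> complex mat) \<Rightarrow> bool" where
  "iid_gaussian_matrix P n G \<longleftrightarrow>
     prob_space P \<and>
     (\<forall>\<omega> \<in> space P. G \<omega> \<in> carrier_mat n n) \<and>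
     prob_space.indep_vars P (\<lambda>_. borel) (\<lambda>(i, j) \<omega>. G \<omega> $$ (i, j)) ({..<n} \<times> {..<n}) \<and>
     (\<forall>i<n. \<forall>j<n. std_complex_gaussian P (\<lambda>\<omega>. G \<omega> $$ (i, j)))"

text \<open>The limit is a constant, so the variables may live on different probability spaces;
  a common space is the case of constant \<open>P\<close>.\<close>

definition tendsto_in_prob_const ::
    "(nat \<Rightarrow> 'a measure) \<Rightarrow> (nat \<Rightarrow> 'a \<Rightarrow> real) \<Rightarrow> real \<Rightarrow> bool" where
  "tendsto_in_prob_const P X c \<longleftrightarrow>
     (\<forall>\<delta>>0. (\<lambda>n. measure (P n) {\<omega> \<in> space (P n). \<bar>X n \<omega> - c\<bar> > \<delta>}) \<longlonglongrightarrow> 0)"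

text \<open>The hypothesis \<open>log\<^sup>+ \<Sigma>\<^sub>1\<^sub>1(z) = o(N)\<close> cannot be dropped. If no index satisfies the inequality
  defining \<open>N\<^sup>*\<close>, the convention \<open>N\<^sup>* = 1\<close> still removes \<open>\<Sigma>\<^sub>1\<^sub>1(z)\<close> from \<open>B\<^sub>N(z)\<close>; for
  \<open>M\<^sub>N = exp(N\<^sup>2) Id\<close>, \<open>z = 0\<close> the difference of the two normalised log-determinants is then
  asymptotic to \<open>N\<close>, although \<open>\<alpha> = 0\<close>. If some index does satisfy it, then
  \<open>\<Sigma>\<^sub>1\<^sub>1(z) < \<epsilon>\<^sub>N\<^sup>-\<^sup>1 N\<^sup>1\<^sup>/\<^sup>2\<^sup>-\<^sup>\<gamma>\<close>, so the hypothesis only concerns the degenerate case.\<close>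

definition smallest_sv_subexponential :: "(nat \<Rightarrow> complex mat) \<Rightarrow> complex \<Rightarrow> bool" where
  "smallest_sv_subexponential M z \<longleftrightarrow>
     (\<lambda>N. ln (max 1 (sing_val (shifted (M N) z) 1)) / real N) \<longlonglongrightarrow> 0"

end

theory Submission
  imports Defs
begin

text \<open>Write \<open>D\<close> for the determinant of \<open>\<Sigma> + \<delta> G\<close> with \<open>\<delta> = N\<^sup>-\<^sup>\<gamma>\<close>, \<open>k\<close> for the threshold index
  \<open>N\<^sup>*\<close>, and \<open>\<sigma>\<^sub>i\<close> for the singular values. The proof compares \<open>log \<bar>D\<bar>\<close> with
  \<open>log \<bar>det B\<bar>\<close> by a second moment from above and an expected logarithm from below. If
  \<open>E exp Y \<le> exp u\<close> and \<open>E Y \<ge> - l\<close> with \<open>u, l \<ge> 0\<close>, then \<open>E \<bar>Y\<bar>\<close> is at most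
  \<open>2 u + l + 2\<close>, so no concentration inequality is needed: it suffices that both bounds are tight
  up to \<open>o(N)\<close> on the scale of \<open>log \<bar>D\<bar>\<close>.

  Upper bound. Expanding along the first row and integrating that row out, the orthogonality of the
  independent centred entries gives \<open>E \<bar>D\<bar>\<^sup>2 \<le> \<Prod>\<^sub>i (\<sigma>\<^sub>i\<^sup>2 + \<delta>\<^sup>2 (N - i + 1))\<close>. The threshold that
  defines \<open>N\<^sup>*\<close> is exactly the one at which the two summands of a factor balance up to
  \<open>\<epsilon>\<^sup>-\<^sup>2\<close>: a factor with \<open>i > k\<close> is \<open>\<sigma>\<^sub>i\<^sup>2\<close> times at most \<open>1 + \<epsilon>\<^sup>2\<close>, and one with \<open>i \<le> k\<close> is
  at most \<open>\<delta>\<^sup>2 N (1 + \<epsilon>\<^sup>-\<^sup>2)\<close>, unless no index satisfies the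
  inequality that defines \<open>N\<^sup>*\<close>; in that case \<open>k = 1\<close> and the only such factor is at most
  \<open>exp (o(N))\<close> by the hypothesis on the smallest singular value.

  Lower bound. As a function of one Gaussian entry, \<open>log \<bar>D\<bar>\<close> is subharmonic, and the law of
  the entry is rotation invariant; hence averaging over a row can only increase the logarithm above its value
  at zero noise. This peels off the rows \<open>i > k\<close> at no loss and leaves
  \<open>log \<bar>det B\<bar>\<close> plus the contribution of the upper left \<open>k \<times> k\<close> block. As a function of one row of
  that block, the determinant is a shifted Gaussian linear form in the cofactors, whose logarithm is on average at
  least the logarithm of its standard deviation minus a constant, whatever the shift. Concavity of the logarithm over the
  cofactors then yields \<open>log (\<delta>\<^sup>k (k!)\<^sup>1\<^sup>/\<^sup>2) - O(k)\<close>.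

  Both bounds give \<open>log \<bar>det B\<bar> + k (1/2 - \<gamma>) log N + o(N)\<close>, because \<open>k log N / N \<rightarrow> \<alpha>\<close> forces
  \<open>k / N \<rightarrow> 0\<close> and therefore \<open>log k! = k log N + o(N)\<close>.

  Throughout, \<open>log \<bar>w\<bar>\<close> is replaced by the nonnegative smooth function
  \<open>log (1 + t \<bar>w\<bar>\<^sup>2) / 2\<close> with \<open>t\<close> large, so that all expectations are nonnegative integrals and
  no integrability has to be discussed before the last step.\<close>

section \<open>A smoothed logarithm and its averages over roots of unity\<close>

text \<open>A nonnegative stand-in for \<open>log \<bar>w\<bar>\<close>: up to the additive constant \<open>log t / 2\<close> it is the
  logarithm of \<open>(\<bar>w\<bar>\<^sup>2 + 1/t)\<^sup>1\<^sup>/\<^sup>2\<close>, which stays subharmonic in \<open>w\<close>.\<close>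

definition smooth_log :: "real \<Rightarrow> complex \<Rightarrow> real" where
  "smooth_log t w = ln (1 + t * (cmod w)\<^sup>2) / 2"

lemma smooth_log_nonneg: "t \<ge> 0 \<Longrightarrow> smooth_log t w \<ge> 0"
  unfolding smooth_log_def by simp

lemma smooth_log_measurable [measurable]: "smooth_log t \<in> borel_measurable borel"
  unfolding smooth_log_def by measurable

lemma smooth_log_mult: "smooth_log t (a * w) = smooth_log (t * (cmod a)\<^sup>2) w"
  unfolding smooth_log_def by (simp add: norm_mult power_mult_distrib mult_ac)

text \<open>The polynomial \<open>X\<^sup>n - 1\<close> splits into distinct linear factors; substitute \<open>X = x / y\<close>.\<close>

lemma prod_roots_of_unity:
  fixes x y :: complex
  assumes n: "n > 0"
  shows "(\<Prod>w | w ^ n = 1. x - w * y) = x ^ n - y ^ n"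
proof (cases "y = 0")
  case True
  have "card {w::complex. w ^ n = 1} = n" using card_roots_unity_eq[OF n] .
  then show ?thesis using True n by (simp add: prod_constant)
next
  case False
  let ?p = "monom 1 n - 1 :: complex poly"
  have ev: "poly ?p w = w ^ n - 1" for w by (simp add: poly_monom)
  have deg: "degree ?p = n"
    using degree_add_eq_left[of "- 1" "monom (1::complex) n"] n by (simp add: degree_monom_eq)
  have lc: "lead_coeff ?p = 1" using n by (simp add: deg)
  have sqf: "rsquarefree ?p"
  proof (subst rsquarefree_roots, intro allI notI)
    fix a assume "poly ?p a = 0 \<and> poly (pderiv ?p) a = 0"
    then have 1: "a ^ n = 1" and 2: "of_nat n * a ^ (n - 1) = 0"
      by (simp_all add: ev pderiv_diff pderiv_monom poly_monom)
    from 2 n have "a = 0" by simp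
    with 1 n show False by (simp add: power_0_left)
  qed
  have "?p = (\<Prod>z | poly ?p z = 0. [:-z, 1:])"
    using complex_poly_decompose_rsquarefree[OF sqf] unfolding lc by (simp only: smult_1_left)
  then have "poly ?p (x / y) = poly (\<Prod>z | poly ?p z = 0. [:-z, 1:]) (x / y)"
    by (rule arg_cong[where f = "\<lambda>q. poly q (x / y)"])
  then have "(x / y) ^ n - 1 = (\<Prod>w | w ^ n = 1. x / y - w)"
    unfolding ev poly_prod by simp
  also have "\<dots> = (\<Prod>w | w ^ n = 1. (x - w * y) / y)"
    using False by (simp add: field_simps)
  also have "\<dots> = (\<Prod>w | w ^ n = 1. x - w * y) / y ^ n"
    using card_roots_unity_eq[OF n] by (simp add: prod_dividef prod_constant)
  finally show ?thesis using False by (simp add: field_simps)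
qed

text \<open>A discrete form of Jensen's formula for the linear function \<open>w \<mapsto> c + e w\<close>, which has no zero in the
  closed unit disc. The average over the \<open>n\<close>-th roots of unity is explicit, namely
  \<open>log \<bar>c\<^sup>n - (-e)\<^sup>n\<bar> / n\<close>, so that no integral over the circle is needed.\<close>

lemma roots_of_unity_average_ln:
  fixes c :: real and e :: complex
  assumes "cmod e < c"
  shows "(\<lambda>n. (\<Sum>w | w ^ Suc n = 1. ln (cmod (c + e * w))) / Suc n) \<longlonglongrightarrow> ln c"
proof -
  have c: "c > 0" using assms norm_ge_zero[of e] by linarith
  define q where "q = - e / c"
  have q: "cmod q < 1" using assms c by (simp add: q_def norm_divide)
  have ne: "1 - q ^ Suc n \<noteq> 0" for n
  proof
    assume "1 - q ^ Suc n = 0"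
    then have "q ^ Suc n = 1" by (simp del: power_Suc)
    with power_eq_1_iff[of q "Suc n"] q show False by simp
  qed
  have eq: "(\<Sum>w | w ^ Suc n = 1. ln (cmod (c + e * w))) / Suc n
             = ln c + ln (cmod (1 - q ^ Suc n)) * inverse (real (Suc n))" for n
  proof -
    have qc: "- e = q * complex_of_real c" using c by (simp add: q_def)
    have "(\<Prod>w | w ^ Suc n = 1. c + e * w) = complex_of_real c ^ Suc n - (- e) ^ Suc n"
      using prod_roots_of_unity[of "Suc n" "complex_of_real c" "- e"] by (simp add: mult_ac)
    also have "\<dots> = complex_of_real c ^ Suc n * (1 - q ^ Suc n)"
      unfolding qc power_mult_distrib by (simp add: algebra_simps)
    finally have P: "(\<Prod>w | w ^ Suc n = 1. c + e * w) = complex_of_real c ^ Suc n * (1 - q ^ Suc n)" .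
    have fin: "finite {w::complex. w ^ Suc n = 1}" by (rule finite_roots_unity) simp
    have nz: "c + e * w \<noteq> 0" if w: "w ^ Suc n = 1" for w
    proof
      assume "c + e * w = 0"
      with w fin have "(\<Prod>w | w ^ Suc n = 1. c + e * w) = 0" by (intro prod_zero) auto
      with P ne[of n] c show False by (simp del: power_Suc)
    qed
    have "(\<Sum>w | w ^ Suc n = 1. ln (cmod (c + e * w))) = ln (\<Prod>w | w ^ Suc n = 1. cmod (c + e * w))"
      using fin nz by (subst ln_prod) auto
    also have "(\<Prod>w | w ^ Suc n = 1. cmod (c + e * w)) = c ^ Suc n * cmod (1 - q ^ Suc n)"
      unfolding prod_norm P norm_mult norm_power using c by simp
    also have "ln \<dots> = Suc n * ln c + ln (cmod (1 - q ^ Suc n))"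
      using c ne[of n] ln_realpow[of c "Suc n"] by (subst ln_mult) (auto simp del: power_Suc)
    finally show ?thesis by (simp add: field_simps)
  qed
  have "(\<lambda>n. q ^ Suc n) \<longlonglongrightarrow> 0" using q by (intro LIMSEQ_Suc LIMSEQ_power_zero) 
  then have "(\<lambda>n. ln (cmod (1 - q ^ Suc n))) \<longlonglongrightarrow> ln (cmod (1 - 0))"
    by (intro tendsto_intros) auto
  then have "(\<lambda>n. ln c + ln (cmod (1 - q ^ Suc n)) * inverse (real (Suc n))) \<longlonglongrightarrow> ln c + ln (cmod (1 - 0)) * 0"
    by (intro tendsto_add[OF tendsto_const] tendsto_mult[OF _ LIMSEQ_inverse_real_of_nat])
  then show ?thesis unfolding eq by (simp only: mult_zero_right add_0_right)
qed

text \<open>On the unit circle the function \<open>1 + t \<bar>a + b w\<bar>\<^sup>2\<close> is a trigonometric polynomial of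
  degree one without zeros, hence equals \<open>\<bar>c + e w\<bar>\<^sup>2\<close> with \<open>c > \<bar>e\<bar>\<close>. Comparing
  coefficients, \<open>c\<^sup>2\<close> is the larger root of a quadratic polynomial whose value at \<open>1 + t \<bar>a\<bar>\<^sup>2\<close> is
  not positive. The averages tend to \<open>log c\<close>, so this is the sub-mean value property of the
  smoothed logarithm.\<close>

lemma smooth_log_roots_of_unity_average:
  assumes t: "t > 0"
  obtains l where "(\<lambda>n. (\<Sum>w | w ^ Suc n = 1. smooth_log t (a + b * w)) / Suc n) \<longlonglongrightarrow> l"
    and "smooth_log t a \<le> l"
proof -
  define p where "p = t * cnj a * b"
  define S where "S = 1 + t * (cmod a)\<^sup>2 + t * (cmod b)\<^sup>2"
  define c2 where "c2 = (S + sqrt (S\<^sup>2 - 4 * (cmod p)\<^sup>2)) / 2"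
  define e where "e = p / sqrt c2"
  have np: "cmod p = t * cmod a * cmod b" using t by (simp add: p_def norm_mult)
  have S1: "S \<ge> 1" using t by (simp add: S_def)
  \<comment> \<open>the discriminant is what makes \<open>c2\<close> at least \<open>1 + t \<bar>a\<bar>\<^sup>2\<close>\<close>
  have disc: "S\<^sup>2 - 4 * (cmod p)\<^sup>2 \<ge> (1 + t * (cmod a)\<^sup>2 - t * (cmod b)\<^sup>2)\<^sup>2"
    unfolding S_def np using t by (simp add: power2_eq_square algebra_simps)
  have disc0: "S\<^sup>2 - 4 * (cmod p)\<^sup>2 > 0"
  proof -
    have "2 * (t * cmod a * cmod b) \<le> t * (cmod a)\<^sup>2 + t * (cmod b)\<^sup>2"
      using mult_left_mono[OF sum_squares_bound[of "cmod a" "cmod b"], of t] t by (simp add: algebra_simps)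
    then have "2 * cmod p < S" unfolding np S_def by linarith
    then have "(2 * cmod p)\<^sup>2 < S\<^sup>2" by (intro power_strict_mono) auto
    then show ?thesis by (simp add: power_mult_distrib)
  qed
  have "1 + t * (cmod a)\<^sup>2 - t * (cmod b)\<^sup>2 \<le> sqrt (S\<^sup>2 - 4 * (cmod p)\<^sup>2)"
    using real_sqrt_le_mono[OF disc] by simp
  then have c2a: "c2 \<ge> 1 + t * (cmod a)\<^sup>2"
    using S_def c2_def by argo
  have c2S: "2 * c2 > S" using disc0 by (simp add: c2_def)
  have c20: "c2 > 0" using c2S S1 by linarith
  have quad: "c2\<^sup>2 + (cmod p)\<^sup>2 = S * c2"
  proof -
    have "2 * c2 - S = sqrt (S\<^sup>2 - 4 * (cmod p)\<^sup>2)" unfolding c2_def by (simp add: field_simps)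
    then have "(2 * c2 - S)\<^sup>2 = S\<^sup>2 - 4 * (cmod p)\<^sup>2" using disc0 by simp
    then show ?thesis by (simp add: power2_eq_square algebra_simps)
  qed
  have ne: "(cmod e)\<^sup>2 = (cmod p)\<^sup>2 / c2" using c20 by (simp add: e_def norm_divide power_divide)
  have sum: "c2 + (cmod e)\<^sup>2 = S" unfolding ne using quad c20 by (simp add: field_simps power2_eq_square)
  have "(cmod e)\<^sup>2 < c2" using sum c2S by linarith
  then have "(cmod e)\<^sup>2 < (sqrt c2)\<^sup>2" using c20 by (metis less_imp_le real_sqrt_pow2)
  then have lt: "cmod e < sqrt c2" by (rule power2_less_imp_less) (use c20 in simp)
  have key: "smooth_log t (a + b * w) = ln (cmod (sqrt c2 + e * w))" if w: "cmod w = 1" for w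
  proof -
    have "complex_of_real (sqrt c2) \<noteq> 0" using c20 by simp
    then have "complex_of_real (sqrt c2) * e = p" unfolding e_def 
      by (metis nonzero_mult_div_cancel_left times_divide_eq_right)
    then have ep: "complex_of_real (sqrt c2) * (e * w) = p * w" by (metis mult.assoc)
    have ew: "cmod (e * w) = cmod e" "cmod (b * w) = cmod b" using w by (simp_all add: norm_mult)
    have n2: "(cmod (x + y))\<^sup>2 = (cmod x)\<^sup>2 + (cmod y)\<^sup>2 + 2 * Re (cnj x * y)" for x y :: complex
      unfolding cmod_power2 by (simp add: power2_eq_square algebra_simps)
    have "(cmod (sqrt c2 + e * w))\<^sup>2 = c2 + (cmod e)\<^sup>2 + 2 * Re (p * w)"
      unfolding n2 ew complex_cnj_complex_of_real ep using c20 by (simp only: norm_of_real power2_abs real_sqrt_pow2 less_imp_le)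
    also have "\<dots> = S + 2 * Re (p * w)" by (simp add: sum)
    also have "\<dots> = 1 + t * (cmod (a + b * w))\<^sup>2"
      unfolding n2 ew S_def p_def by (simp add: algebra_simps)
    finally have "smooth_log t (a + b * w) = ln ((cmod (sqrt c2 + e * w))\<^sup>2) / 2"
      by (simp add: smooth_log_def)
    then show ?thesis by (simp add: ln_realpow)
  qed
  have avg: "(\<Sum>w | w ^ Suc n = 1. smooth_log t (a + b * w)) = (\<Sum>w | w ^ Suc n = 1. ln (cmod (sqrt c2 + e * w)))" for n
  proof (rule sum.cong[OF refl])
    fix w :: complex assume "w \<in> {w. w ^ Suc n = 1}"
    then have "cmod w = 1" using power_eq_1_iff[of w "Suc n"] by blast
    then show "smooth_log t (a + b * w) = ln (cmod (sqrt c2 + e * w))" by (rule key)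
  qed
  have "(\<lambda>n. (\<Sum>w | w ^ Suc n = 1. smooth_log t (a + b * w)) / Suc n) \<longlonglongrightarrow> ln (sqrt c2)"
    unfolding avg by (rule roots_of_unity_average_ln[OF lt])
  moreover have "smooth_log t a \<le> ln (sqrt c2)"
  proof -
    have "ln (1 + t * (cmod a)\<^sup>2) \<le> ln c2" using c2a t by (subst ln_le_cancel_iff) (auto intro!: add_pos_nonneg c20)
    then show ?thesis using c20 by (simp add: smooth_log_def ln_sqrt)
  qed
  ultimately show ?thesis by (rule that)
qed

section \<open>The standard complex Gaussian law\<close>

definition complex_gaussian :: "complex measure" where
  "complex_gaussian =
     distr (density lborel (normal_density 0 (sqrt (1/2))) \<Otimes>\<^sub>M density lborel (normal_density 0 (sqrt (1/2))))
       borel (\<lambda>(x, y). Complex x y)"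

lemma measurable_Complex [measurable]: "(\<lambda>(x, y). Complex x y) \<in> borel_measurable (borel \<Otimes>\<^sub>M borel)"
  unfolding Complex_eq by measurable

lemma prob_space_normal: "prob_space (density lborel (\<lambda>x. ennreal (normal_density 0 (sqrt (1/2)) x)))"
  by (rule prob_space_normal_density) simp

lemma prob_space_complex_gaussian: "prob_space complex_gaussian"
proof -
  interpret N: prob_space "density lborel (\<lambda>x. ennreal (normal_density 0 (sqrt (1/2)) x))"
    by (rule prob_space_normal)
  interpret pair_prob_space "density lborel (\<lambda>x. ennreal (normal_density 0 (sqrt (1/2)) x))"
    "density lborel (\<lambda>x. ennreal (normal_density 0 (sqrt (1/2)) x))" ..
  show ?thesis unfolding complex_gaussian_def
    by (rule prob_space_distr) measurable
qed

lemma sets_complex_gaussian [measurable_cong, simp]: "sets complex_gaussian = sets borel"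
  unfolding complex_gaussian_def by simp

lemma space_complex_gaussian [simp]: "space complex_gaussian = UNIV"
  unfolding complex_gaussian_def by simp

lemma normal_density_half: "normal_density 0 (sqrt (1/2)) x = exp (- x\<^sup>2) / sqrt pi"
  by (simp add: normal_density_def)

text \<open>The density depends on the modulus only; all invariance properties below are read off from this formula.\<close>

lemma nn_integral_complex_gaussian:
  assumes [measurable]: "f \<in> borel_measurable borel"
  shows "(\<integral>\<^sup>+ w. f w \<partial>complex_gaussian)
    = (\<integral>\<^sup>+ p. f (Complex (fst p) (snd p)) * ennreal (exp (- ((fst p)\<^sup>2 + (snd p)\<^sup>2)) / pi) \<partial>(lborel \<Otimes>\<^sub>M lborel))"
proof -
  let ?N = "density lborel (\<lambda>x. ennreal (normal_density 0 (sqrt (1/2)) x))"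
  interpret N: prob_space ?N by (rule prob_space_normal)
  have [measurable]: "(\<lambda>x. f (Complex (fst x) (snd x))) \<in> borel_measurable (borel \<Otimes>\<^sub>M borel)"
    unfolding Complex_eq by measurable
  have C2 [measurable]: "(\<lambda>y. f (Complex x y)) \<in> borel_measurable borel" for x
    unfolding Complex_eq by measurable
  have [measurable]: "(\<lambda>p. f (Complex (fst p) (snd p))) \<in> borel_measurable (?N \<Otimes>\<^sub>M ?N)"
    by (simp cong: measurable_cong_sets)
  have "(\<integral>\<^sup>+ w. f w \<partial>complex_gaussian) = (\<integral>\<^sup>+ p. f (Complex (fst p) (snd p)) \<partial>(?N \<Otimes>\<^sub>M ?N))"
    unfolding complex_gaussian_def by (subst nn_integral_distr) (auto simp: case_prod_beta)
  also have "\<dots> = (\<integral>\<^sup>+ x. \<integral>\<^sup>+ y. f (Complex x y) \<partial>?N \<partial>?N)"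
    by (subst N.nn_integral_fst[symmetric]) auto
  also have "\<dots> = (\<integral>\<^sup>+ x. \<integral>\<^sup>+ y. f (Complex x y) * ennreal (exp (- (x\<^sup>2 + y\<^sup>2)) / pi) \<partial>lborel \<partial>lborel)"
  proof -
    have [measurable]: "(\<lambda>p. f (Complex (fst p) (snd p))) \<in> borel_measurable (lborel \<Otimes>\<^sub>M lborel)"
      by (simp cong: measurable_cong_sets)
    have 1: "(\<integral>\<^sup>+ y. f (Complex x y) \<partial>?N) = (\<integral>\<^sup>+ y. ennreal (normal_density 0 (sqrt (1/2)) y) * f (Complex x y) \<partial>lborel)" for x
      by (subst nn_integral_density) auto
    have "(\<integral>\<^sup>+ x. \<integral>\<^sup>+ y. f (Complex x y) \<partial>?N \<partial>?N)
       = (\<integral>\<^sup>+ x. ennreal (normal_density 0 (sqrt (1/2)) x) * (\<integral>\<^sup>+ y. ennreal (normal_density 0 (sqrt (1/2)) y) * f (Complex x y) \<partial>lborel) \<partial>lborel)"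
      unfolding 1 by (subst nn_integral_density) (auto simp: Complex_eq)
    also have "\<dots> = (\<integral>\<^sup>+ x. \<integral>\<^sup>+ y. ennreal (normal_density 0 (sqrt (1/2)) x) * (ennreal (normal_density 0 (sqrt (1/2)) y) * f (Complex x y)) \<partial>lborel \<partial>lborel)"
      by (intro nn_integral_cong nn_integral_cmult[symmetric]) (auto simp: Complex_eq)
    also have "\<dots> = (\<integral>\<^sup>+ x. \<integral>\<^sup>+ y. f (Complex x y) * ennreal (exp (- (x\<^sup>2 + y\<^sup>2)) / pi) \<partial>lborel \<partial>lborel)"
    proof (intro nn_integral_cong)
      fix x y :: real
      have "ennreal (normal_density 0 (sqrt (1/2)) x) * ennreal (normal_density 0 (sqrt (1/2)) y)
          = ennreal (exp (- (x\<^sup>2 + y\<^sup>2)) / pi)"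
        unfolding normal_density_half by (subst ennreal_mult[symmetric]) (auto simp: exp_add[symmetric])
      then show "ennreal (normal_density 0 (sqrt (1/2)) x) * (ennreal (normal_density 0 (sqrt (1/2)) y) * f (Complex x y))
         = f (Complex x y) * ennreal (exp (- (x\<^sup>2 + y\<^sup>2)) / pi)"
        by (metis mult.assoc mult.commute)
    qed
    finally show ?thesis .
  qed
  also have "\<dots> = (\<integral>\<^sup>+ p. f (Complex (fst p) (snd p)) * ennreal (exp (- ((fst p)\<^sup>2 + (snd p)\<^sup>2)) / pi) \<partial>(lborel \<Otimes>\<^sub>M lborel))"
    by (subst lborel.nn_integral_fst[symmetric]) (auto simp: Complex_eq)
  finally show ?thesis .
qed

lemma nn_integral_lborel_translate:
  fixes f :: "'a::euclidean_space \<Rightarrow> ennreal"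
  assumes [measurable]: "f \<in> borel_measurable borel"
  shows "(\<integral>\<^sup>+ x. f (x + v) \<partial>lborel) = (\<integral>\<^sup>+ x. f x \<partial>lborel)"
proof -
  have "(\<integral>\<^sup>+ x. f x \<partial>lborel) = (\<integral>\<^sup>+ x. f x \<partial>distr lborel borel ((+) v))"
    by (simp add: lborel_distr_plus)
  also have "\<dots> = (\<integral>\<^sup>+ x. f (x + v) \<partial>lborel)"
    by (subst nn_integral_distr) (auto simp: add.commute)
  finally show ?thesis ..
qed

lemma nn_integral_shear_fst:
  fixes F :: "'a::euclidean_space \<times> 'a \<Rightarrow> ennreal"
  assumes F: "F \<in> borel_measurable (borel \<Otimes>\<^sub>M borel)"
  shows "(\<integral>\<^sup>+ p. F (fst p + s *\<^sub>R snd p, snd p) \<partial>(lborel \<Otimes>\<^sub>M lborel)) = (\<integral>\<^sup>+ p. F p \<partial>(lborel \<Otimes>\<^sub>M lborel))"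
proof -
  note [measurable] = F
  have "(\<integral>\<^sup>+ p. F (fst p + s *\<^sub>R snd p, snd p) \<partial>(lborel \<Otimes>\<^sub>M lborel))
      = (\<integral>\<^sup>+ y. \<integral>\<^sup>+ x. F (x + s *\<^sub>R y, y) \<partial>lborel \<partial>lborel)"
    by (subst lborel_pair.nn_integral_snd[symmetric]) auto
  also have "\<dots> = (\<integral>\<^sup>+ y. \<integral>\<^sup>+ x. F (x, y) \<partial>lborel \<partial>lborel)"
    by (intro nn_integral_cong nn_integral_lborel_translate) measurable
  also have "\<dots> = (\<integral>\<^sup>+ p. F p \<partial>(lborel \<Otimes>\<^sub>M lborel))"
    by (subst lborel_pair.nn_integral_snd[symmetric]) auto
  finally show ?thesis .
qed

lemma nn_integral_shear_snd:
  fixes F :: "'a::euclidean_space \<times> 'a \<Rightarrow> ennreal"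
  assumes F: "F \<in> borel_measurable (borel \<Otimes>\<^sub>M borel)"
  shows "(\<integral>\<^sup>+ p. F (fst p, snd p + s *\<^sub>R fst p) \<partial>(lborel \<Otimes>\<^sub>M lborel)) = (\<integral>\<^sup>+ p. F p \<partial>(lborel \<Otimes>\<^sub>M lborel))"
proof -
  note [measurable] = F
  have "(\<integral>\<^sup>+ p. F (fst p, snd p + s *\<^sub>R fst p) \<partial>(lborel \<Otimes>\<^sub>M lborel))
      = (\<integral>\<^sup>+ x. \<integral>\<^sup>+ y. F (x, y + s *\<^sub>R x) \<partial>lborel \<partial>lborel)"
    by (subst lborel.nn_integral_fst[symmetric]) auto
  also have "\<dots> = (\<integral>\<^sup>+ x. \<integral>\<^sup>+ y. F (x, y) \<partial>lborel \<partial>lborel)"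
    by (intro nn_integral_cong nn_integral_lborel_translate) measurable
  also have "\<dots> = (\<integral>\<^sup>+ p. F p \<partial>(lborel \<Otimes>\<^sub>M lborel))"
    by (subst lborel.nn_integral_fst[symmetric]) auto
  finally show ?thesis .
qed

text \<open>A rotation by an angle other than \<open>\<pi>\<close> is a product of three shears, and each shear preserves
  Lebesgue measure by Fubini and translation invariance. The statement is for pairs of vectors because it is
  needed twice: over the reals for the rotation invariance of one complex Gaussian, and over the plane for the
  sum of two independent ones.\<close>

lemma nn_integral_lborel_rotate:
  fixes F :: "'a::euclidean_space \<times> 'a \<Rightarrow> ennreal"
  assumes F: "F \<in> borel_measurable (borel \<Otimes>\<^sub>M borel)"
    and cs: "c\<^sup>2 + s\<^sup>2 = 1" and c1: "c \<noteq> -1"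
  shows "(\<integral>\<^sup>+ p. F (c *\<^sub>R fst p - s *\<^sub>R snd p, s *\<^sub>R fst p + c *\<^sub>R snd p) \<partial>(lborel \<Otimes>\<^sub>M lborel))
    = (\<integral>\<^sup>+ p. F p \<partial>(lborel \<Otimes>\<^sub>M lborel))"
proof -
  note [measurable] = F
  \<comment> \<open>\<open>T\<close> is the tangent of half the angle of rotation\<close>
  define T where "T = s / (1 + c)"
  have c1': "1 + c \<noteq> 0" using c1 by auto
  have "s * s = (1 - c) * (1 + c)" using cs by (simp add: power2_eq_square algebra_simps)
  then have Ts: "s * T = 1 - c" using c1' by (simp add: T_def field_simps)
  have Tc: "T * (1 + c) = s" using c1' by (simp add: T_def)
  define F1 where "F1 p = F (fst p + (-T) *\<^sub>R snd p, snd p)" for p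
  define F2 where "F2 p = F1 (fst p, snd p + s *\<^sub>R fst p)" for p
  have F1m [measurable]: "F1 \<in> borel_measurable (borel \<Otimes>\<^sub>M borel)" unfolding F1_def by measurable
  have F2m [measurable]: "F2 \<in> borel_measurable (borel \<Otimes>\<^sub>M borel)" unfolding F2_def by measurable
  have rot: "F2 (x + (-T) *\<^sub>R y, y) = F (c *\<^sub>R x - s *\<^sub>R y, s *\<^sub>R x + c *\<^sub>R y)" for x y
  proof -
    have a: "y + s *\<^sub>R (x + (-T) *\<^sub>R y) = s *\<^sub>R x + c *\<^sub>R y"
    proof -
      have "y + s *\<^sub>R (x + (-T) *\<^sub>R y) = s *\<^sub>R x + (1 - s * T) *\<^sub>R y" by (simp add: algebra_simps)
      then show ?thesis by (simp add: Ts)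
    qed
    have b: "(x + (-T) *\<^sub>R y) + (-T) *\<^sub>R (s *\<^sub>R x + c *\<^sub>R y) = c *\<^sub>R x - s *\<^sub>R y"
    proof -
      have "(x + (-T) *\<^sub>R y) + (-T) *\<^sub>R (s *\<^sub>R x + c *\<^sub>R y) = (1 - s * T) *\<^sub>R x - (T * (1 + c)) *\<^sub>R y"
        by (simp add: algebra_simps)
      then show ?thesis by (simp only: Ts Tc) simp
    qed
    show ?thesis unfolding F2_def F1_def fst_conv snd_conv a b ..
  qed
  have "(\<integral>\<^sup>+ p. F (c *\<^sub>R fst p - s *\<^sub>R snd p, s *\<^sub>R fst p + c *\<^sub>R snd p) \<partial>(lborel \<Otimes>\<^sub>M lborel))
      = (\<integral>\<^sup>+ p. F2 (fst p + (-T) *\<^sub>R snd p, snd p) \<partial>(lborel \<Otimes>\<^sub>M lborel))"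
    unfolding rot ..
  also have "\<dots> = (\<integral>\<^sup>+ p. F2 p \<partial>(lborel \<Otimes>\<^sub>M lborel))" by (rule nn_integral_shear_fst[OF F2m])
  also have "\<dots> = (\<integral>\<^sup>+ p. F1 p \<partial>(lborel \<Otimes>\<^sub>M lborel))"
    unfolding F2_def by (rule nn_integral_shear_snd[OF F1m])
  also have "\<dots> = (\<integral>\<^sup>+ p. F p \<partial>(lborel \<Otimes>\<^sub>M lborel))"
    unfolding F1_def by (rule nn_integral_shear_fst[OF F])
  finally show ?thesis .
qed

text \<open>The half-turn, where the three shears degenerate, is the square of the quarter-turn.\<close>

lemma complex_gaussian_rotate:
  assumes f: "f \<in> borel_measurable borel" and w: "cmod w = 1"
  shows "(\<integral>\<^sup>+ g. f (w * g) \<partial>complex_gaussian) = (\<integral>\<^sup>+ g. f g \<partial>complex_gaussian)"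
proof -
  have main: "(\<integral>\<^sup>+ g. f (w * g) \<partial>complex_gaussian) = (\<integral>\<^sup>+ g. f g \<partial>complex_gaussian)"
    if f [measurable]: "f \<in> borel_measurable borel" and w: "cmod w = 1" "Re w \<noteq> -1" for f w
  proof -
    define c s where "c = Re w" and "s = Im w"
    have cs: "c\<^sup>2 + s\<^sup>2 = 1" using w(1) by (simp add: c_def s_def cmod_def)
    define F where "F p = f (Complex (fst p) (snd p)) * ennreal (exp (- ((fst p)\<^sup>2 + (snd p)\<^sup>2)) / pi)" for p
    have F [measurable]: "F \<in> borel_measurable (borel \<Otimes>\<^sub>M borel)"
      unfolding F_def Complex_eq by measurable
    have "(\<integral>\<^sup>+ g. f (w * g) \<partial>complex_gaussian)
        = (\<integral>\<^sup>+ p. F (c *\<^sub>R fst p - s *\<^sub>R snd p, s *\<^sub>R fst p + c *\<^sub>R snd p) \<partial>(lborel \<Otimes>\<^sub>M lborel))"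
    proof (subst nn_integral_complex_gaussian, measurable, intro nn_integral_cong)
      fix p :: "real \<times> real"
      have e: "(c * fst p - s * snd p)\<^sup>2 + (s * fst p + c * snd p)\<^sup>2 = (c\<^sup>2 + s\<^sup>2) * ((fst p)\<^sup>2 + (snd p)\<^sup>2)"
        by (simp add: power2_eq_square algebra_simps)
      have g: "w * Complex (fst p) (snd p) = Complex (c * fst p - s * snd p) (s * fst p + c * snd p)"
        by (simp add: complex_eq_iff c_def s_def)
      show "f (w * Complex (fst p) (snd p)) * ennreal (exp (- ((fst p)\<^sup>2 + (snd p)\<^sup>2)) / pi)
          = F (c *\<^sub>R fst p - s *\<^sub>R snd p, s *\<^sub>R fst p + c *\<^sub>R snd p)"
        unfolding F_def fst_conv snd_conv real_scaleR_def e cs g by simp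
    qed
    also have "\<dots> = (\<integral>\<^sup>+ p. F p \<partial>(lborel \<Otimes>\<^sub>M lborel))"
      using w(2) by (intro nn_integral_lborel_rotate F cs) (simp add: c_def)
    also have "\<dots> = (\<integral>\<^sup>+ g. f g \<partial>complex_gaussian)"
      unfolding F_def by (rule nn_integral_complex_gaussian[symmetric]) measurable
    finally show ?thesis .
  qed
  show ?thesis
  proof (cases "Re w = -1")
    case False then show ?thesis using main f w by blast
  next
    case True
    then have "Im w = 0" using w by (simp add: cmod_def)
    with True have w1: "w = \<i> * \<i>" by (simp add: complex_eq_iff)
    have "(\<integral>\<^sup>+ g. f (\<i> * (\<i> * g)) \<partial>complex_gaussian) = (\<integral>\<^sup>+ g. f (\<i> * g) \<partial>complex_gaussian)"
      using f by (intro main[of "\<lambda>g. f (\<i> * g)"]) auto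
    also have "\<dots> = (\<integral>\<^sup>+ g. f g \<partial>complex_gaussian)" using f by (intro main) auto
    finally show ?thesis by (simp add: w1 mult.assoc)
  qed
qed

text \<open>Stability of the Gaussian law under sums: rotate the pair of independent variables so that the first coordinate
  becomes the normalised sum.\<close>

lemma complex_gaussian_add:
  assumes f [measurable]: "f \<in> borel_measurable borel" and pos: "\<alpha> \<ge> 0" "\<beta> \<ge> 0"
  shows "(\<integral>\<^sup>+ y. \<integral>\<^sup>+ g. f (complex_of_real \<alpha> * y + complex_of_real \<beta> * g) \<partial>complex_gaussian \<partial>complex_gaussian)
    = (\<integral>\<^sup>+ g. f (complex_of_real (sqrt (\<alpha>\<^sup>2 + \<beta>\<^sup>2)) * g) \<partial>complex_gaussian)"
proof (cases "\<alpha> = 0 \<and> \<beta> = 0")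
  case True
  interpret prob_space complex_gaussian by (rule prob_space_complex_gaussian)
  show ?thesis using True emeasure_space_1 by simp
next
  case False
  interpret prob_space complex_gaussian by (rule prob_space_complex_gaussian)
  define r where "r = sqrt (\<alpha>\<^sup>2 + \<beta>\<^sup>2)"
  have r: "r > 0" "r\<^sup>2 = \<alpha>\<^sup>2 + \<beta>\<^sup>2" using False by (auto simp: r_def sum_power2_gt_zero_iff)
  define C where "C p = Complex (fst p) (snd p)" for p
  define d where "d p = exp (- ((fst p)\<^sup>2 + (snd p)\<^sup>2)) / pi" for p :: "real \<times> real"
  have Cm [measurable]: "C \<in> borel_measurable borel" "C \<in> borel_measurable lborel"
    unfolding C_def Complex_eq by (simp_all flip: borel_prod)
  have dm [measurable]: "d \<in> borel_measurable borel"
    unfolding d_def by (simp flip: borel_prod)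
  have int: "(\<integral>\<^sup>+ w. h w \<partial>complex_gaussian) = (\<integral>\<^sup>+ p. h (C p) * ennreal (d p) \<partial>lborel)"
    if "h \<in> borel_measurable borel" for h
    using nn_integral_complex_gaussian[OF that] by (simp add: lborel_prod C_def d_def)
  define F where "F P = f (complex_of_real r * C (fst P)) * ennreal (d (fst P) * d (snd P))" for P
  have Fm [measurable]: "F \<in> borel_measurable (borel \<Otimes>\<^sub>M borel)" unfolding F_def by measurable
  have dpos: "d p \<ge> 0" for p by (simp add: d_def)
  have Clin: "C (a *\<^sub>R p - b *\<^sub>R q) = of_real a * C p - of_real b * C q" for a b p q
    by (simp add: C_def complex_eq_iff)
  have dn: "d p = exp (- (norm p)\<^sup>2) / pi" for p
    by (simp add: d_def norm_prod_def)
  define c s where "c = \<alpha> / r" and "s = - (\<beta> / r)"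
  have "c\<^sup>2 + s\<^sup>2 = (\<alpha>\<^sup>2 + \<beta>\<^sup>2) / r\<^sup>2"
    unfolding c_def s_def by (simp add: power_divide add_divide_distrib)
  also have "\<dots> = 1" using r by (metis divide_self less_numeral_extra(3) zero_less_power)
  finally have cs: "c\<^sup>2 + s\<^sup>2 = 1" .
  have "c \<ge> 0" using r pos by (simp add: c_def)
  then have c1: "c \<noteq> -1" by auto
  have rot: "F (c *\<^sub>R p - s *\<^sub>R q, s *\<^sub>R p + c *\<^sub>R q)
      = f (complex_of_real \<alpha> * C p + complex_of_real \<beta> * C q) * ennreal (d p * d q)" for p q
  proof -
    have 1: "complex_of_real r * C (c *\<^sub>R p - s *\<^sub>R q) = complex_of_real \<alpha> * C p + complex_of_real \<beta> * C q"
      unfolding Clin c_def s_def using r(1) by (simp add: algebra_simps)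
    have "(norm (c *\<^sub>R p - s *\<^sub>R q))\<^sup>2 + (norm (s *\<^sub>R p + c *\<^sub>R q))\<^sup>2 = (c\<^sup>2 + s\<^sup>2) * ((norm p)\<^sup>2 + (norm q)\<^sup>2)"
      unfolding power2_norm_eq_inner by (simp add: inner_simps inner_commute power2_eq_square algebra_simps)
    then have "d (c *\<^sub>R p - s *\<^sub>R q) * d (s *\<^sub>R p + c *\<^sub>R q) = d p * d q"
      unfolding dn cs by (simp add: exp_add[symmetric])
    then show ?thesis unfolding F_def fst_conv snd_conv 1 by simp
  qed
  have split: "(\<integral>\<^sup>+ y. \<integral>\<^sup>+ g. h y g \<partial>complex_gaussian \<partial>complex_gaussian)
      = (\<integral>\<^sup>+ P. h (C (fst P)) (C (snd P)) * ennreal (d (fst P) * d (snd P)) \<partial>(lborel \<Otimes>\<^sub>M lborel))"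
    if hm [measurable]: "case_prod h \<in> borel_measurable (borel \<Otimes>\<^sub>M borel)" for h
  proof -
    have [measurable]: "(\<lambda>g. h y g) \<in> borel_measurable borel" for y
      using measurable_compose[OF measurable_Pair1' hm, of y] by simp
    have [measurable]: "(\<lambda>y. \<integral>\<^sup>+ g. h y g \<partial>complex_gaussian) \<in> borel_measurable borel"
      by (rule borel_measurable_nn_integral) (simp cong: measurable_cong_sets)
    have [measurable]: "(\<lambda>P. h (C (fst P)) (C (snd P))) \<in> borel_measurable (borel \<Otimes>\<^sub>M borel)"
      using measurable_compose[OF _ hm, of "\<lambda>P. (C (fst P), C (snd P))" "borel \<Otimes>\<^sub>M borel"] by simp
    have "(\<integral>\<^sup>+ y. \<integral>\<^sup>+ g. h y g \<partial>complex_gaussian \<partial>complex_gaussian)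
        = (\<integral>\<^sup>+ p. (\<integral>\<^sup>+ q. h (C p) (C q) * ennreal (d q) \<partial>lborel) * ennreal (d p) \<partial>lborel)"
      by (subst int, measurable, subst int, measurable)
    also have "\<dots> = (\<integral>\<^sup>+ p. \<integral>\<^sup>+ q. h (C p) (C q) * ennreal (d p * d q) \<partial>lborel \<partial>lborel)"
      by (intro nn_integral_cong, subst nn_integral_multc[symmetric])
         (auto simp: ennreal_mult dpos mult_ac)
    also have "\<dots> = (\<integral>\<^sup>+ P. h (C (fst P)) (C (snd P)) * ennreal (d (fst P) * d (snd P)) \<partial>(lborel \<Otimes>\<^sub>M lborel))"
      by (subst lborel.nn_integral_fst[symmetric]) auto
    finally show ?thesis .
  qed
  have "(\<integral>\<^sup>+ y. \<integral>\<^sup>+ g. f (complex_of_real \<alpha> * y + complex_of_real \<beta> * g) \<partial>complex_gaussian \<partial>complex_gaussian)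
      = (\<integral>\<^sup>+ P. F (c *\<^sub>R fst P - s *\<^sub>R snd P, s *\<^sub>R fst P + c *\<^sub>R snd P) \<partial>(lborel \<Otimes>\<^sub>M lborel))"
    unfolding rot by (rule split) measurable
  also have "\<dots> = (\<integral>\<^sup>+ P. F P \<partial>(lborel \<Otimes>\<^sub>M lborel))"
    by (rule nn_integral_lborel_rotate[OF Fm cs c1])
  also have "\<dots> = (\<integral>\<^sup>+ y. \<integral>\<^sup>+ g. f (complex_of_real r * y) \<partial>complex_gaussian \<partial>complex_gaussian)"
    unfolding F_def by (rule split[symmetric]) measurable
  also have "\<dots> = (\<integral>\<^sup>+ y. f (complex_of_real r * y) \<partial>complex_gaussian)"
    using emeasure_space_1 by simp
  finally show ?thesis unfolding r_def .
qed

lemma normal_second_moment: "(\<integral>\<^sup>+ x. ennreal (x\<^sup>2) \<partial>(density lborel (\<lambda>x. ennreal (normal_density 0 (sqrt (1/2)) x)))) = ennreal (1/2)"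
proof -
  have "(\<integral>\<^sup>+ x. ennreal (x\<^sup>2) \<partial>(density lborel (\<lambda>x. ennreal (normal_density 0 (sqrt (1/2)) x))))
     = (\<integral>\<^sup>+ x. ennreal (normal_density 0 (sqrt (1/2)) x * (x - 0) ^ (2 * 1)) \<partial>lborel)"
    by (subst nn_integral_density) (auto simp: ennreal_mult)
  also have "\<dots> = ennreal (fact (2 * 1) / ((2 / (sqrt (1/2))\<^sup>2) ^ 1 * fact 1))"
  proof -
    have "has_bochner_integral lborel (\<lambda>x. normal_density 0 (sqrt (1/2)) x * (x - 0) ^ (2 * 1)) (fact (2 * 1) / ((2 / (sqrt (1/2))\<^sup>2) ^ 1 * fact 1))"
      by (rule normal_moment_even) simp
    then have int: "integrable lborel (\<lambda>x. normal_density 0 (sqrt (1/2)) x * (x - 0) ^ (2 * 1))"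
      and val: "(LBINT x. normal_density 0 (sqrt (1/2)) x * (x - 0) ^ (2 * 1)) = fact (2 * 1) / ((2 / (sqrt (1/2))\<^sup>2) ^ 1 * fact 1)"
      unfolding has_bochner_integral_iff by blast+
    show ?thesis
      unfolding val[symmetric] by (rule nn_integral_eq_integral[OF int]) simp
  qed
  finally show ?thesis by simp
qed

lemma complex_gaussian_second_moment: "(\<integral>\<^sup>+ g. ennreal ((cmod g)\<^sup>2) \<partial>complex_gaussian) = 1"
proof -
  let ?N = "density lborel (\<lambda>x. ennreal (normal_density 0 (sqrt (1/2)) x))"
  interpret N: prob_space ?N by (rule prob_space_normal)
  have "(\<integral>\<^sup>+ g. ennreal ((cmod g)\<^sup>2) \<partial>complex_gaussian) = (\<integral>\<^sup>+ p. ennreal ((fst p)\<^sup>2 + (snd p)\<^sup>2) \<partial>(?N \<Otimes>\<^sub>M ?N))"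
    unfolding complex_gaussian_def by (subst nn_integral_distr) (auto simp: case_prod_beta cmod_power2)
  also have "\<dots> = (\<integral>\<^sup>+ x. \<integral>\<^sup>+ y. ennreal (x\<^sup>2 + y\<^sup>2) \<partial>?N \<partial>?N)"
    by (subst N.nn_integral_fst[symmetric]) auto
  also have "\<dots> = (\<integral>\<^sup>+ x. ennreal (x\<^sup>2) + ennreal (1/2) \<partial>?N)"
  proof (rule nn_integral_cong)
    fix x
    show "(\<integral>\<^sup>+ y. ennreal (x\<^sup>2 + y\<^sup>2) \<partial>?N) = ennreal (x\<^sup>2) + ennreal (1/2)"
      using normal_second_moment N.emeasure_space_1
      by (simp add: ennreal_plus nn_integral_add del: ennreal_plus[symmetric])
  qed
  also have "\<dots> = ennreal (1/2) + ennreal (1/2)"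
    using normal_second_moment N.emeasure_space_1 by (subst nn_integral_add) auto
  also have "\<dots> = 1" by (subst ennreal_plus[symmetric]) simp_all
  finally show ?thesis .
qed

text \<open>Averaging over the sign of \<open>g\<close> removes the cross terms.\<close>

lemma complex_gaussian_second_moment_affine:
  "(\<integral>\<^sup>+ g. ennreal ((cmod (a + b * g))\<^sup>2) \<partial>complex_gaussian) = ennreal ((cmod a)\<^sup>2 + (cmod b)\<^sup>2)"
proof -
  interpret prob_space complex_gaussian by (rule prob_space_complex_gaussian)
  have "2 * (\<integral>\<^sup>+ g. ennreal ((cmod (a + b * g))\<^sup>2) \<partial>complex_gaussian)
      = (\<integral>\<^sup>+ g. ennreal ((cmod (a + b * g))\<^sup>2) \<partial>complex_gaussian) + (\<integral>\<^sup>+ g. ennreal ((cmod (a + b * (-1 * g)))\<^sup>2) \<partial>complex_gaussian)"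
    by (subst complex_gaussian_rotate[of "\<lambda>g. ennreal ((cmod (a + b * g))\<^sup>2)" "-1"]) (auto simp: mult_2)
  also have "\<dots> = (\<integral>\<^sup>+ g. ennreal (2 * (cmod a)\<^sup>2) + ennreal (2 * (cmod b)\<^sup>2) * ennreal ((cmod g)\<^sup>2) \<partial>complex_gaussian)"
  proof (subst nn_integral_add[symmetric], measurable, intro nn_integral_cong)
    fix g
    have "(cmod (a + b * g))\<^sup>2 + (cmod (a + b * (-1 * g)))\<^sup>2 = 2 * (cmod a)\<^sup>2 + 2 * (cmod (b * g))\<^sup>2"
      unfolding cmod_power2 by (simp add: power2_eq_square algebra_simps)
    then show "ennreal ((cmod (a + b * g))\<^sup>2) + ennreal ((cmod (a + b * (-1 * g)))\<^sup>2) = ennreal (2 * (cmod a)\<^sup>2) + ennreal (2 * (cmod b)\<^sup>2) * ennreal ((cmod g)\<^sup>2)"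
      by (simp add: ennreal_mult[symmetric] norm_mult power_mult_distrib flip: ennreal_plus)
  qed
  also have "\<dots> = ennreal (2 * (cmod a)\<^sup>2) + ennreal (2 * (cmod b)\<^sup>2)"
    using emeasure_space_1 complex_gaussian_second_moment
    by (subst nn_integral_add) (auto simp: nn_integral_cmult)
  also have "\<dots> = ennreal (2 * ((cmod a)\<^sup>2 + (cmod b)\<^sup>2))"
    unfolding distrib_left by (rule ennreal_plus[symmetric]) auto
  also have "\<dots> = ennreal 2 * ennreal ((cmod a)\<^sup>2 + (cmod b)\<^sup>2)"
    by (rule ennreal_mult) auto
  finally have "2 * (\<integral>\<^sup>+ g. ennreal ((cmod (a + b * g))\<^sup>2) \<partial>complex_gaussian)
      = 2 * ennreal ((cmod a)\<^sup>2 + (cmod b)\<^sup>2)" by (simp only: ennreal_numeral)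
  then show ?thesis unfolding ennreal_mult_cancel_left by (simp del: ennreal_plus)
qed

section \<open>Expected logarithms of affine functions of a Gaussian\<close>

text \<open>The sub-mean value property for the Gaussian law. By rotation invariance the integral is unchanged if the
  integrand is averaged over the \<open>n\<close>-th roots of unity; let \<open>n\<close> tend to infinity and use Fatou's
  lemma.\<close>

lemma complex_gaussian_smooth_log_ge:
  assumes t: "t > 0"
  shows "ennreal (smooth_log t a) \<le> (\<integral>\<^sup>+ g. ennreal (smooth_log t (a + b * g)) \<partial>complex_gaussian)"
proof -
  interpret prob_space complex_gaussian by (rule prob_space_complex_gaussian)
  let ?I = "\<integral>\<^sup>+ g. ennreal (smooth_log t (a + b * g)) \<partial>complex_gaussian"
  define u where "u n g = (\<Sum>w | w ^ Suc n = 1. ennreal (inverse (Suc n)) * ennreal (smooth_log t (a + b * (w * g))))"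
    for n :: nat and g :: complex
  have um: "u n \<in> borel_measurable complex_gaussian" for n
    unfolding u_def by measurable
  have Iu: "(\<integral>\<^sup>+ g. u n g \<partial>complex_gaussian) = ?I" for n
  proof -
    have rot: "(\<integral>\<^sup>+ g. ennreal (smooth_log t (a + b * (w * g))) \<partial>complex_gaussian) = ?I" if "w ^ Suc n = 1" for w :: complex
      using power_eq_1_iff[OF that]
      by (intro complex_gaussian_rotate[of "\<lambda>g. ennreal (smooth_log t (a + b * g))"]) auto
    have "(\<integral>\<^sup>+ g. u n g \<partial>complex_gaussian)
        = (\<Sum>w::complex | w ^ Suc n = 1. ennreal (inverse (Suc n)) * ?I)"
      unfolding u_def by (subst nn_integral_sum, measurable, intro sum.cong refl, subst nn_integral_cmult, measurable)
        (simp only: rot mem_Collect_eq)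
    also have "\<dots> = (of_nat (Suc n) * ennreal (inverse (Suc n))) * ?I"
      using card_roots_unity_eq[of "Suc n"] by (simp add: mult.assoc del: power_Suc)
    also have "of_nat (Suc n) * ennreal (inverse (Suc n)) = 1"
      by (subst ennreal_of_nat_eq_real_of_nat, subst ennreal_mult[symmetric]) (simp_all del: of_nat_Suc)
    finally show ?thesis by simp
  qed
  have lim: "ennreal (smooth_log t a) \<le> liminf (\<lambda>n. u n g)" for g
  proof -
    obtain l where l: "(\<lambda>n. (\<Sum>w | w ^ Suc n = 1. smooth_log t (a + (b * g) * w)) / Suc n) \<longlonglongrightarrow> l"
      and le: "smooth_log t a \<le> l" by (rule smooth_log_roots_of_unity_average[OF t])
    have "u n g = ennreal ((\<Sum>w | w ^ Suc n = 1. smooth_log t (a + (b * g) * w)) / Suc n)" for n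
    proof -
      have "u n g = (\<Sum>w::complex | w ^ Suc n = 1. ennreal (inverse (Suc n) * smooth_log t (a + (b * g) * w)))"
        unfolding u_def using t by (intro sum.cong refl, subst ennreal_mult) (auto simp: smooth_log_nonneg mult_ac)
      also have "\<dots> = ennreal (\<Sum>w::complex | w ^ Suc n = 1. inverse (Suc n) * smooth_log t (a + (b * g) * w))"
        using t by (intro sum_ennreal) (simp add: smooth_log_nonneg)
      finally show ?thesis by (simp only: sum_distrib_left[symmetric] divide_inverse mult.commute)
    qed
    then have "(\<lambda>n. u n g) \<longlonglongrightarrow> ennreal l" using tendsto_ennrealI[OF l] by simp
    then have "liminf (\<lambda>n. u n g) = ennreal l" by (intro lim_imp_Liminf) auto
    then show ?thesis using le by (simp add: ennreal_leI)
  qed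
  have "ennreal (smooth_log t a) = (\<integral>\<^sup>+ g. ennreal (smooth_log t a) \<partial>complex_gaussian)"
    using emeasure_space_1 by simp
  also have "\<dots> \<le> (\<integral>\<^sup>+ g. liminf (\<lambda>n. u n g) \<partial>complex_gaussian)"
    by (intro nn_integral_mono lim)
  also have "\<dots> \<le> liminf (\<lambda>n. \<integral>\<^sup>+ g. u n g \<partial>complex_gaussian)"
    by (rule nn_integral_liminf[OF um])
  also have "\<dots> = ?I" unfolding Iu by (intro lim_imp_Liminf) auto
  finally show ?thesis .
qed

text \<open>An integrable majorant of the negative part of \<open>log \<bar>x\<bar>\<close> that is infinite at \<open>0\<close>. As
  a sum of indicators of small intervals its expectation needs only the small ball probabilities of a Gaussian.\<close>

definition log_depth :: "real \<Rightarrow> ennreal" where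
  "log_depth x = (\<Sum>k. indicator {y. \<bar>y\<bar> \<le> exp (- real k)} x)"

lemma log_depth_measurable [measurable]: "log_depth \<in> borel_measurable borel"
  unfolding log_depth_def by measurable

lemma log_depth_ge:
  assumes "\<bar>x\<bar> \<le> exp (- real n)"
  shows "ennreal (real n + 1) \<le> log_depth x"
proof -
  have "ennreal (real n + 1) = of_nat (Suc n)"
    unfolding ennreal_of_nat_eq_real_of_nat by (rule arg_cong[where f = ennreal]) simp
  also have "\<dots> = (\<Sum>k<Suc n. (1::ennreal))" by (simp only: sum_constant card_lessThan mult_1_right)
  also have "\<dots> \<le> (\<Sum>k<Suc n. indicator {y. \<bar>y\<bar> \<le> exp (- real k)} x)"
  proof (rule sum_mono)
    fix k assume "k \<in> {..<Suc n}"
    then have "exp (- real n) \<le> exp (- real k)" by simp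
    then show "1 \<le> (indicator {y. \<bar>y\<bar> \<le> exp (- real k)} x :: ennreal)"
      using order_trans[OF assms] by (simp add: indicator_def)
  qed
  also have "\<dots> \<le> log_depth x" unfolding log_depth_def by (rule sum_le_suminf) auto
  finally show ?thesis .
qed

text \<open>A bound for the expected \<open>log_depth\<close> of a shifted Gaussian, uniform in the shift: the density is at most
  \<open>1 / sqrt \<pi>\<close>, so an interval of radius \<open>r\<close> has probability at most \<open>2 r / sqrt \<pi>\<close>.\<close>

definition shift_loss :: real where
  "shift_loss = 2 / sqrt pi * (\<Sum>k. exp (- real k))"

lemma summable_exp_neg: "summable (\<lambda>k. exp (- real k))"
proof -
  have "summable (\<lambda>k. exp (- 1 :: real) ^ k)" by (intro summable_geometric) simp
  then show ?thesis by (simp add: exp_of_nat_mult[symmetric])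
qed

lemma shift_loss_nonneg: "shift_loss \<ge> 0"
  unfolding shift_loss_def using summable_exp_neg by (intro mult_nonneg_nonneg suminf_nonneg) auto

lemma complex_gaussian_log_depth:
  "(\<integral>\<^sup>+ g. log_depth (m + Re g) \<partial>complex_gaussian) \<le> ennreal shift_loss"
proof -
  let ?N = "density lborel (\<lambda>x. ennreal (normal_density 0 (sqrt (1/2)) x))"
  interpret N: prob_space ?N by (rule prob_space_normal)
  have slab: "(\<integral>\<^sup>+ x. indicator {y. \<bar>y\<bar> \<le> r} (m + x) \<partial>?N) \<le> ennreal (2 / sqrt pi * r)" if r: "r \<ge> 0" for r
  proof -
    have "(\<integral>\<^sup>+ x. indicator {y. \<bar>y\<bar> \<le> r} (m + x) \<partial>?N)
        = (\<integral>\<^sup>+ x. ennreal (normal_density 0 (sqrt (1/2)) x) * indicator {y. \<bar>y\<bar> \<le> r} (m + x) \<partial>lborel)"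
      by (subst nn_integral_density) auto
    also have "\<dots> \<le> (\<integral>\<^sup>+ x. ennreal (1 / sqrt pi) * indicator {-m-r..-m+r} x \<partial>lborel)"
      by (intro nn_integral_mono mult_mono ennreal_leI)
         (auto simp: normal_density_half divide_right_mono split: split_indicator)
    also have "\<dots> = ennreal (1 / sqrt pi) * ennreal (2 * r)"
      using r by (subst nn_integral_cmult) auto
    also have "\<dots> = ennreal (2 / sqrt pi * r)" using r by (subst ennreal_mult[symmetric]) auto
    finally show ?thesis .
  qed
  have "(\<integral>\<^sup>+ g. log_depth (m + Re g) \<partial>complex_gaussian) = (\<integral>\<^sup>+ p. log_depth (m + fst p) \<partial>(?N \<Otimes>\<^sub>M ?N))"
    unfolding complex_gaussian_def by (subst nn_integral_distr) (auto simp: case_prod_beta)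
  also have "\<dots> = (\<integral>\<^sup>+ x. \<integral>\<^sup>+ y. log_depth (m + x) \<partial>?N \<partial>?N)"
    by (subst N.nn_integral_fst[symmetric]) auto
  also have "\<dots> = (\<integral>\<^sup>+ x. log_depth (m + x) \<partial>?N)" using N.emeasure_space_1 by simp
  also have "\<dots> = (\<Sum>k. \<integral>\<^sup>+ x. indicator {y. \<bar>y\<bar> \<le> exp (- real k)} (m + x) \<partial>?N)"
    unfolding log_depth_def by (rule nn_integral_suminf) measurable
  also have "\<dots> \<le> (\<Sum>k. ennreal (2 / sqrt pi * exp (- real k)))"
    by (intro suminf_le slab) auto
  also have "\<dots> = ennreal (\<Sum>k. 2 / sqrt pi * exp (- real k))"
    by (intro suminf_ennreal2 summable_mult summable_exp_neg) simp
  also have "\<dots> = ennreal shift_loss"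
    unfolding shift_loss_def by (simp only: suminf_mult[OF summable_exp_neg])
  finally show ?thesis .
qed

text \<open>However it is shifted, a Gaussian of scale \<open>s\<close> has an expected logarithm of at least
  \<open>log s\<close> minus a universal constant: with \<open>x\<close> the real part of
  \<open>a / s + g\<close>, \<open>\<bar>a + s g\<bar> \<ge> s \<bar>x\<bar>\<close>, and \<open>log \<bar>x\<bar>\<close> has small negative part on average.\<close>

lemma complex_gaussian_smooth_log_ge_scale:
  assumes t: "t > 0" and s: "s \<ge> 0"
  shows "ennreal (ln (1 + t * s\<^sup>2) / 2)
    \<le> (\<integral>\<^sup>+ g. ennreal (smooth_log t (a + complex_of_real s * g)) \<partial>complex_gaussian) + ennreal shift_loss"
proof (cases "s = 0")
  case True then show ?thesis by simp
next
  case False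
  with s have s: "s > 0" by simp
  interpret prob_space complex_gaussian by (rule prob_space_complex_gaussian)
  define m where "m = Re a / s"
  define L where "L = ln (1 + t * s\<^sup>2) / 2"
  have L0: "L \<ge> 0" using t by (simp add: L_def)
  have pt: "ennreal L \<le> ennreal (smooth_log t (a + complex_of_real s * g)) + log_depth (m + Re g)" for g
  proof -
    let ?x = "m + Re g"
    have "s * \<bar>?x\<bar> = \<bar>Re (a + complex_of_real s * g)\<bar>"
    proof -
      have "s * \<bar>?x\<bar> = \<bar>s * ?x\<bar>" using s by (simp add: abs_mult)
      also have "s * ?x = Re (a + complex_of_real s * g)" using s by (simp add: m_def field_simps)
      finally show ?thesis .
    qed
    then have "s * \<bar>?x\<bar> \<le> cmod (a + complex_of_real s * g)" using abs_Re_le_cmod by metis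
    then have sq: "(s * \<bar>?x\<bar>)\<^sup>2 \<le> (cmod (a + complex_of_real s * g))\<^sup>2" using s by (intro power_mono) auto
    have h: "ln (1 + t * (s * \<bar>?x\<bar>)\<^sup>2) / 2 \<le> smooth_log t (a + complex_of_real s * g)"
      unfolding smooth_log_def using t sq
      by (intro divide_right_mono ln_mono mult_left_mono add_left_mono) (auto intro: add_pos_nonneg)
    consider "?x = 0" | "\<bar>?x\<bar> \<ge> 1" | "?x \<noteq> 0" "\<bar>?x\<bar> < 1" by linarith
    then show ?thesis
    proof cases
      case 1
      obtain n :: nat where "L \<le> real n" using real_arch_simple by blast
      then have "ennreal L \<le> ennreal (real n + 1)" by (intro ennreal_leI) simp
      also have "\<dots> \<le> log_depth ?x" using 1 by (intro log_depth_ge) simp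
      finally show ?thesis by (simp add: add_increasing)
    next
      case 2
      have "s\<^sup>2 \<le> (s * \<bar>?x\<bar>)\<^sup>2" using s 2 by (intro power_mono) auto
      then have "L \<le> ln (1 + t * (s * \<bar>?x\<bar>)\<^sup>2) / 2"
        unfolding L_def using t
        by (intro divide_right_mono ln_mono mult_left_mono add_left_mono) (auto intro: add_pos_nonneg)
      with h have "L \<le> smooth_log t (a + complex_of_real s * g)" by linarith
      then show ?thesis by (simp add: ennreal_leI add_increasing2)
    next
      case 3
      define n where "n = nat \<lfloor>- ln \<bar>?x\<bar>\<rfloor>"
      have lx: "ln \<bar>?x\<bar> < 0" using 3 by simp
      then have n1: "real n \<le> - ln \<bar>?x\<bar>" and n2: "- ln \<bar>?x\<bar> \<le> real n + 1" by (auto simp: n_def)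
      have "\<bar>?x\<bar> = exp (ln \<bar>?x\<bar>)" using 3 by simp
      also have "\<dots> \<le> exp (- real n)" using n1 by simp
      finally have d: "ennreal (real n + 1) \<le> log_depth ?x" by (rule log_depth_ge)
      have "?x\<^sup>2 \<le> 1" using 3 by (simp add: abs_square_le_1)
      then have "?x\<^sup>2 * (1 + t * s\<^sup>2) \<le> 1 + t * (s * \<bar>?x\<bar>)\<^sup>2"
        by (simp add: power_mult_distrib algebra_simps)
      then have "ln (?x\<^sup>2 * (1 + t * s\<^sup>2)) \<le> ln (1 + t * (s * \<bar>?x\<bar>)\<^sup>2)"
        using 3 t by (intro ln_mono mult_pos_pos) (auto intro: add_pos_nonneg)
      moreover have "ln (?x\<^sup>2 * (1 + t * s\<^sup>2)) = 2 * ln \<bar>?x\<bar> + 2 * L"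
      proof -
        have "1 + t * s\<^sup>2 > 0" using t by (intro add_pos_nonneg) auto
        moreover have "ln (?x\<^sup>2) = 2 * ln \<bar>?x\<bar>" using 3 ln_realpow[of "\<bar>?x\<bar>" 2] by simp
        ultimately show ?thesis using 3 by (subst ln_mult) (auto simp: L_def)
      qed
      ultimately have "L \<le> smooth_log t (a + complex_of_real s * g) + (real n + 1)" using h n2 by linarith
      then have "ennreal L \<le> ennreal (smooth_log t (a + complex_of_real s * g) + (real n + 1))"
        by (rule ennreal_leI)
      also have "\<dots> = ennreal (smooth_log t (a + complex_of_real s * g)) + ennreal (real n + 1)"
        using t by (intro ennreal_plus smooth_log_nonneg) auto
      finally show ?thesis using d by (meson add_left_mono order_trans)
    qed
  qed
  have "ennreal L = (\<integral>\<^sup>+ g. ennreal L \<partial>complex_gaussian)" using emeasure_space_1 by simp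
  also have "\<dots> \<le> (\<integral>\<^sup>+ g. ennreal (smooth_log t (a + complex_of_real s * g)) + log_depth (m + Re g) \<partial>complex_gaussian)"
    by (intro nn_integral_mono pt)
  also have "\<dots> = (\<integral>\<^sup>+ g. ennreal (smooth_log t (a + complex_of_real s * g)) \<partial>complex_gaussian)
       + (\<integral>\<^sup>+ g. log_depth (m + Re g) \<partial>complex_gaussian)"
    by (rule nn_integral_add) measurable
  also have "\<dots> \<le> (\<integral>\<^sup>+ g. ennreal (smooth_log t (a + complex_of_real s * g)) \<partial>complex_gaussian) + ennreal shift_loss"
    by (intro add_left_mono complex_gaussian_log_depth)
  finally show ?thesis unfolding L_def .
qed

lemma measurable_gaussian_component:
  assumes "j \<in> J" shows "(\<lambda>x. x j) \<in> borel_measurable (Pi\<^sub>M J (\<lambda>_. complex_gaussian))"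
  using measurable_component_singleton[OF assms, of "\<lambda>_. complex_gaussian"] by (simp cong: measurable_cong_sets)

text \<open>A linear form in independent standard Gaussians is a multiple of a single one. Thus the statements about one
  Gaussian variable apply to a whole row of the matrix.\<close>

lemma gaussian_linear_form:
  assumes "finite J" and "f \<in> borel_measurable borel"
  shows "(\<integral>\<^sup>+ x. f (\<Sum>j\<in>J. c j * x j) \<partial>Pi\<^sub>M J (\<lambda>_. complex_gaussian))
    = (\<integral>\<^sup>+ g. f (complex_of_real (sqrt (\<Sum>j\<in>J. (cmod (c j))\<^sup>2)) * g) \<partial>complex_gaussian)"
  using assms
proof (induction J arbitrary: f)
  case empty
  interpret prob_space complex_gaussian by (rule prob_space_complex_gaussian)
  show ?case using emeasure_space_1 by (simp add: PiM_empty nn_integral_count_space_finite)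
next
  case (insert i J)
  interpret cg: prob_space complex_gaussian by (rule prob_space_complex_gaussian)
  interpret product_sigma_finite "\<lambda>_. complex_gaussian" ..
  note [measurable] = insert.prems
  let ?G = "Pi\<^sub>M J (\<lambda>_. complex_gaussian)"
  define s where "s = sqrt (\<Sum>j\<in>J. (cmod (c j))\<^sup>2)"
  have s: "s \<ge> 0" "s\<^sup>2 = (\<Sum>j\<in>J. (cmod (c j))\<^sup>2)" by (auto simp: s_def sum_nonneg)
  have m: "(\<lambda>x. \<Sum>j\<in>insert i J. c j * x j) \<in> borel_measurable (Pi\<^sub>M (insert i J) (\<lambda>_. complex_gaussian))"
    by (intro borel_measurable_sum borel_measurable_times borel_measurable_const measurable_gaussian_component)
  have upd: "(\<Sum>j\<in>insert i J. c j * (x(i := y)) j) = (\<Sum>j\<in>J. c j * x j) + c i * y" for x y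
  proof -
    have "(\<Sum>j\<in>J. c j * (x(i := y)) j) = (\<Sum>j\<in>J. c j * x j)"
      using insert.hyps by (intro sum.cong) auto
    then show ?thesis using insert.hyps by (simp add: add.commute)
  qed
  define F where "F u = (\<integral>\<^sup>+ y. f (u + c i * y) \<partial>complex_gaussian)" for u
  have Fm: "F \<in> borel_measurable borel"
    unfolding F_def by measurable
  obtain w where w: "cmod w = 1" "c i = complex_of_real (cmod (c i)) * w"
  proof (cases "c i = 0")
    case True then show ?thesis using that[of 1] by simp
  next
    case False
    then have "cmod (c i / complex_of_real (cmod (c i))) = 1" by (simp add: norm_divide)
    moreover have "c i = complex_of_real (cmod (c i)) * (c i / complex_of_real (cmod (c i)))" using False by simp
    ultimately show ?thesis by (rule that)
  qed
  have Frot: "F u = (\<integral>\<^sup>+ y. f (u + complex_of_real (cmod (c i)) * y) \<partial>complex_gaussian)" for u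
  proof -
    have "(\<lambda>y. f (u + complex_of_real (cmod (c i)) * y)) \<in> borel_measurable borel" by measurable
    from complex_gaussian_rotate[OF this w(1)] show ?thesis
      unfolding F_def mult.assoc[symmetric] w(2)[symmetric] .
  qed
  have "(\<integral>\<^sup>+ x. f (\<Sum>j\<in>insert i J. c j * x j) \<partial>Pi\<^sub>M (insert i J) (\<lambda>_. complex_gaussian))
      = (\<integral>\<^sup>+ x. \<integral>\<^sup>+ y. f (\<Sum>j\<in>insert i J. c j * (x(i := y)) j) \<partial>complex_gaussian \<partial>?G)"
    using m insert.hyps by (subst product_nn_integral_insert) auto
  also have "\<dots> = (\<integral>\<^sup>+ x. F (\<Sum>j\<in>J. c j * x j) \<partial>?G)" unfolding upd F_def ..
  also have "\<dots> = (\<integral>\<^sup>+ g. F (complex_of_real s * g) \<partial>complex_gaussian)"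
    unfolding s_def by (rule insert.IH[OF Fm])
  also have "\<dots> = (\<integral>\<^sup>+ g. f (complex_of_real (sqrt (s\<^sup>2 + (cmod (c i))\<^sup>2)) * g) \<partial>complex_gaussian)"
    unfolding Frot by (rule complex_gaussian_add) (use s in auto)
  also have "s\<^sup>2 + (cmod (c i))\<^sup>2 = (\<Sum>j\<in>insert i J. (cmod (c j))\<^sup>2)"
    using insert.hyps s by (simp add: add.commute)
  finally show ?case .
qed

section \<open>Determinants perturbed by Gaussian noise\<close>

text \<open>Minors of \<open>\<mu> + \<delta> x\<close> on \<open>m\<close> consecutive rows from \<open>s\<close> on and the columns listed by
  \<open>\<kappa>\<close>. Since the first or the last row is always the one removed, the rows stay consecutive, whereas
  the remaining columns may become arbitrary.\<close>

definition noisy_minor ::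
  "(nat \<times> nat \<Rightarrow> complex) \<Rightarrow> real \<Rightarrow> (nat \<times> nat \<Rightarrow> complex) \<Rightarrow> nat \<Rightarrow> nat \<Rightarrow> (nat \<Rightarrow> nat) \<Rightarrow> complex" where
  "noisy_minor \<mu> \<delta> x s m \<kappa> =
     Determinant.det (Matrix.mat m m (\<lambda>(i, j). \<mu> (s + i, \<kappa> j) + complex_of_real \<delta> * x (s + i, \<kappa> j)))"

lemma noisy_minor_0 [simp]: "noisy_minor \<mu> \<delta> x s 0 \<kappa> = 1"
  unfolding noisy_minor_def by (rule det_dim_zero) auto

lemma noisy_minor_cong:
  assumes "\<And>i j. i < m \<Longrightarrow> j < m \<Longrightarrow> x (s + i, \<kappa> j) = x' (s + i, \<kappa> j)"
  shows "noisy_minor \<mu> \<delta> x s m \<kappa> = noisy_minor \<mu> \<delta> x' s m \<kappa>"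
  unfolding noisy_minor_def using assms by (intro arg_cong[where f = Determinant.det] eq_matI) auto

lemma noisy_minor_cong_cols:
  assumes "\<And>j. j < m \<Longrightarrow> \<kappa> j = \<kappa>' j"
  shows "noisy_minor \<mu> \<delta> x s m \<kappa> = noisy_minor \<mu> \<delta> x s m \<kappa>'"
  unfolding noisy_minor_def using assms by (intro arg_cong[where f = Determinant.det] eq_matI) auto

lemma noisy_minor_measurable:
  assumes "\<And>i j. i < m \<Longrightarrow> j < m \<Longrightarrow> (s + i, \<kappa> j) \<in> J"
  shows "(\<lambda>x. noisy_minor \<mu> \<delta> x s m \<kappa>) \<in> borel_measurable (Pi\<^sub>M J (\<lambda>_. complex_gaussian))"
proof -
  have eq: "noisy_minor \<mu> \<delta> x s m \<kappa> = (\<Sum>p | p permutes {0..<m}. of_int (sign p) *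
      (\<Prod>i = 0..<m. \<mu> (s + i, \<kappa> (p i)) + complex_of_real \<delta> * x (s + i, \<kappa> (p i))))" for x
    unfolding noisy_minor_def Determinant.det_def
    by (auto intro!: sum.cong prod.cong simp: permutes_in_image)
  show ?thesis unfolding eq
  proof (intro borel_measurable_sum borel_measurable_times borel_measurable_prod borel_measurable_add
      borel_measurable_const measurable_gaussian_component assms)
    fix p i assume "p \<in> {p. p permutes {0..<m}}" "i \<in> {0..<m}"
    then show "i < m" "p i < m" using permutes_in_image[of p "{0..<m}" i] by auto
  qed
qed

lemma noisy_minor_expand_first_row:
  "noisy_minor \<mu> \<delta> x s (Suc m) \<kappa> = (\<Sum>j<Suc m. (\<mu> (s, \<kappa> j) + complex_of_real \<delta> * x (s, \<kappa> j)) *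
     ((-1) ^ j * noisy_minor \<mu> \<delta> x (Suc s) m (\<kappa> \<circ> insert_index j)))"
proof -
  let ?A = "Matrix.mat (Suc m) (Suc m) (\<lambda>(i, j). \<mu> (s + i, \<kappa> j) + complex_of_real \<delta> * x (s + i, \<kappa> j))"
  have "mat_delete ?A 0 j = Matrix.mat m m (\<lambda>(i, l). \<mu> (Suc s + i, (\<kappa> \<circ> insert_index j) l)
        + complex_of_real \<delta> * x (Suc s + i, (\<kappa> \<circ> insert_index j) l))" if "j < Suc m" for j
    using that by (intro eq_matI) (auto simp: mat_delete_def insert_index_def)
  then show ?thesis unfolding noisy_minor_def
    by (subst laplace_expansion_row[of ?A "Suc m" 0]) (auto simp: cofactor_def intro!: sum.cong)
qed

lemma noisy_minor_expand_last_row: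
  "noisy_minor \<mu> \<delta> x s (Suc m) \<kappa> = (\<Sum>j<Suc m. (\<mu> (s + m, \<kappa> j) + complex_of_real \<delta> * x (s + m, \<kappa> j)) *
     ((-1) ^ (m + j) * noisy_minor \<mu> \<delta> x s m (\<kappa> \<circ> insert_index j)))"
proof -
  let ?A = "Matrix.mat (Suc m) (Suc m) (\<lambda>(i, j). \<mu> (s + i, \<kappa> j) + complex_of_real \<delta> * x (s + i, \<kappa> j))"
  have "mat_delete ?A m j = Matrix.mat m m (\<lambda>(i, l). \<mu> (s + i, (\<kappa> \<circ> insert_index j) l)
        + complex_of_real \<delta> * x (s + i, (\<kappa> \<circ> insert_index j) l))" if "j < Suc m" for j
    using that by (intro eq_matI) (auto simp: mat_delete_def insert_index_def)
  then show ?thesis unfolding noisy_minor_def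
    by (subst laplace_expansion_row[of ?A "Suc m" m]) (auto simp: cofactor_def intro!: sum.cong)
qed

lemma insert_index_cols:
  assumes "inj_on \<kappa> {..<Suc m}" "\<kappa> ` {..<Suc m} \<subseteq> K" "j < Suc m"
  shows "inj_on (\<kappa> \<circ> insert_index j) {..<m}" "(\<kappa> \<circ> insert_index j) ` {..<m} \<subseteq> K"
proof -
  have im: "insert_index j ` {..<m} \<subseteq> {..<Suc m}" by (auto simp: insert_index_def)
  have "inj_on (insert_index j) {..<m}" by (auto simp: inj_on_def insert_index_def split: if_splits)
  then show "inj_on (\<kappa> \<circ> insert_index j) {..<m}"
    using inj_on_subset[OF assms(1) im] by (rule comp_inj_on)
  show "(\<kappa> \<circ> insert_index j) ` {..<m} \<subseteq> K" using im assms(2) by (auto simp: image_comp[symmetric])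
qed

lemma sum_reindex_supported:
  assumes "inj_on \<tau> I" "\<tau> ` I \<subseteq> B" "finite B" "\<And>b. b \<notin> \<tau> ` I \<Longrightarrow> h b = 0"
  shows "(\<Sum>b\<in>B. h b) = (\<Sum>j\<in>I. h (\<tau> j))"
proof -
  have "(\<Sum>b\<in>B. h b) = (\<Sum>b\<in>\<tau> ` I. h b)"
    using assms by (intro sum.mono_neutral_right) auto
  then show ?thesis using assms(1) by (simp add: sum.reindex)
qed

text \<open>Fubini for one row of the matrix: \<open>B\<close> indexes that row and \<open>A\<close> the others. The cofactors
  \<open>C j\<close> do not involve the row, which therefore enters through a Gaussian linear form.\<close>

lemma integrate_out_row:
  assumes fin: "finite A" "finite B" "A \<inter> B = {}"
    and f: "f \<in> borel_measurable borel"
    and \<tau>: "inj_on \<tau> {..<k}" "\<tau> ` {..<k} \<subseteq> B"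
    and Cm: "\<And>j. j < k \<Longrightarrow> C j \<in> borel_measurable (Pi\<^sub>M (A \<union> B) (\<lambda>_. complex_gaussian))"
    and CA: "\<And>j x y. j < k \<Longrightarrow> C j (merge A B (x, y)) = C j x"
  shows "(\<integral>\<^sup>+ x. f (\<Sum>j<k. (\<mu> j + complex_of_real \<delta> * x (\<tau> j)) * C j x) \<partial>Pi\<^sub>M (A \<union> B) (\<lambda>_. complex_gaussian))
    = (\<integral>\<^sup>+ x. \<integral>\<^sup>+ g. f ((\<Sum>j<k. \<mu> j * C j x) + complex_of_real (\<bar>\<delta>\<bar> * sqrt (\<Sum>j<k. (cmod (C j x))\<^sup>2)) * g)
        \<partial>complex_gaussian \<partial>Pi\<^sub>M A (\<lambda>_. complex_gaussian))"
proof -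
  interpret cg: prob_space complex_gaussian by (rule prob_space_complex_gaussian)
  interpret product_sigma_finite "\<lambda>_. complex_gaussian" ..
  note [measurable] = f
  have m: "(\<lambda>x. \<Sum>j<k. (\<mu> j + complex_of_real \<delta> * x (\<tau> j)) * C j x) \<in> borel_measurable (Pi\<^sub>M (A \<union> B) (\<lambda>_. complex_gaussian))"
    using \<tau>(2) by (intro borel_measurable_sum borel_measurable_times borel_measurable_add borel_measurable_const
        measurable_gaussian_component Cm) auto
  have notA: "\<tau> j \<notin> A" "\<tau> j \<in> B" if "j < k" for j using \<tau>(2) fin(3) that by auto
  have merge\<tau>: "merge A B (x, y) (\<tau> j) = y (\<tau> j)" if "j < k" for x y :: "'a \<Rightarrow> complex" and j
    using notA[OF that] by (simp add: merge_def)
  have inner: "(\<integral>\<^sup>+ y. f (\<Sum>j<k. (\<mu> j + complex_of_real \<delta> * merge A B (x, y) (\<tau> j)) * C j (merge A B (x, y))) \<partial>Pi\<^sub>M B (\<lambda>_. complex_gaussian))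
     = (\<integral>\<^sup>+ g. f ((\<Sum>j<k. \<mu> j * C j x) + complex_of_real (\<bar>\<delta>\<bar> * sqrt (\<Sum>j<k. (cmod (C j x))\<^sup>2)) * g) \<partial>complex_gaussian)" for x
  proof -
    define c where "c b = (if b \<in> \<tau> ` {..<k} then complex_of_real \<delta> * C (the_inv_into {..<k} \<tau> b) x else 0)" for b
    have c\<tau>: "c (\<tau> j) = complex_of_real \<delta> * C j x" if "j < k" for j
      using that \<tau>(1) by (simp add: c_def the_inv_into_f_f)
    have c0: "c b = 0" if "b \<notin> \<tau> ` {..<k}" for b using that by (simp add: c_def)
    note sum_c = sum_reindex_supported[OF \<tau> fin(2)]
    have lin: "(\<Sum>b\<in>B. c b * y b) = (\<Sum>j<k. complex_of_real \<delta> * C j x * y (\<tau> j))" for y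
      by (subst sum_c) (auto simp: c0 c\<tau> intro!: sum.cong)
    have "(\<Sum>b\<in>B. (cmod (c b))\<^sup>2) = (\<Sum>j<k. (cmod (complex_of_real \<delta> * C j x))\<^sup>2)"
      by (subst sum_c) (auto simp: c0 c\<tau> intro!: sum.cong)
    also have "\<dots> = \<delta>\<^sup>2 * (\<Sum>j<k. (cmod (C j x))\<^sup>2)"
      by (simp add: norm_mult power_mult_distrib sum_distrib_left)
    finally have var: "sqrt (\<Sum>b\<in>B. (cmod (c b))\<^sup>2) = \<bar>\<delta>\<bar> * sqrt (\<Sum>j<k. (cmod (C j x))\<^sup>2)"
      by (simp add: real_sqrt_mult)
    have "(\<integral>\<^sup>+ y. f (\<Sum>j<k. (\<mu> j + complex_of_real \<delta> * merge A B (x, y) (\<tau> j)) * C j (merge A B (x, y))) \<partial>Pi\<^sub>M B (\<lambda>_. complex_gaussian))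
        = (\<integral>\<^sup>+ y. f ((\<Sum>j<k. \<mu> j * C j x) + (\<Sum>b\<in>B. c b * y b)) \<partial>Pi\<^sub>M B (\<lambda>_. complex_gaussian))"
    proof (intro nn_integral_cong arg_cong[where f = f])
      fix y
      show "(\<Sum>j<k. (\<mu> j + complex_of_real \<delta> * merge A B (x, y) (\<tau> j)) * C j (merge A B (x, y)))
          = (\<Sum>j<k. \<mu> j * C j x) + (\<Sum>b\<in>B. c b * y b)"
        unfolding lin sum.distrib[symmetric]
        by (intro sum.cong refl) (simp add: CA merge\<tau> algebra_simps)
    qed
    also have "\<dots> = (\<integral>\<^sup>+ g. f ((\<Sum>j<k. \<mu> j * C j x) + complex_of_real (sqrt (\<Sum>b\<in>B. (cmod (c b))\<^sup>2)) * g) \<partial>complex_gaussian)"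
      by (rule gaussian_linear_form[OF fin(2), of "\<lambda>u. f ((\<Sum>j<k. \<mu> j * C j x) + u)"]) measurable
    finally show ?thesis unfolding var .
  qed
  show ?thesis
    unfolding inner[symmetric] using m fin by (intro product_nn_integral_fold) auto
qed

text \<open>Expand along the first row. A row of the mean has at most one nonzero entry, also after columns have been removed,
  so the mean part contributes at most a single squared cofactor, with weight \<open>\<sigma>\<^sub>s\<^sup>2\<close>, and the noise
  contributes \<open>\<delta>\<^sup>2\<close> times the sum of all \<open>m\<close> squared cofactors. Every cofactor obeys the
  same bound by induction, because the bound depends on the rows only.\<close>

lemma noisy_minor_second_moment:
  fixes \<sigma> :: "nat \<Rightarrow> real"
  defines "\<mu> \<equiv> \<lambda>(i, j). if i = j then complex_of_real (\<sigma> i) else 0"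
  assumes "inj_on \<kappa> {..<m}" "\<kappa> ` {..<m} \<subseteq> {..<n}"
  shows "(\<integral>\<^sup>+ x. ennreal ((cmod (noisy_minor \<mu> \<delta> x s m \<kappa>))\<^sup>2) \<partial>Pi\<^sub>M ({s..<s + m} \<times> {..<n}) (\<lambda>_. complex_gaussian))
    \<le> ennreal (\<Prod>i<m. (\<sigma> (s + i))\<^sup>2 + \<delta>\<^sup>2 * (m - i))"
  using assms(2,3)
proof (induction m arbitrary: s \<kappa>)
  case 0
  interpret prob_space complex_gaussian by (rule prob_space_complex_gaussian)
  show ?case by (simp add: PiM_empty nn_integral_count_space_finite)
next
  case (Suc m)
  interpret cg: prob_space complex_gaussian by (rule prob_space_complex_gaussian)
  let ?A = "{Suc s..<Suc s + m} \<times> {..<n}" and ?B = "{s} \<times> {..<n}"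
  let ?P = "Pi\<^sub>M ?A (\<lambda>_. complex_gaussian)"
  define C where "C j x = (-1) ^ j * noisy_minor \<mu> \<delta> x (Suc s) m (\<kappa> \<circ> insert_index j)" for j x
  define p where "p = (\<Prod>i<m. (\<sigma> (Suc s + i))\<^sup>2 + \<delta>\<^sup>2 * (m - i))"
  have p0: "p \<ge> 0" unfolding p_def by (intro prod_nonneg) auto
  have AB: "{s..<s + Suc m} \<times> {..<n} = ?A \<union> ?B" by auto
  note cols = insert_index_cols[OF Suc.prems]
  have idx: "(Suc s + i, (\<kappa> \<circ> insert_index j) l) \<in> ?A" if "j < Suc m" "i < m" "l < m" for i j l
    using cols(2)[OF that(1)] that by (auto simp: image_subset_iff)
  have Cm: "C j \<in> borel_measurable (Pi\<^sub>M (?A \<union> ?B) (\<lambda>_. complex_gaussian))" if "j < Suc m" for j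
    unfolding C_def using idx[OF that] by (intro borel_measurable_times borel_measurable_const noisy_minor_measurable) blast
  have CmA [measurable]: "j < Suc m \<Longrightarrow> C j \<in> borel_measurable ?P" for j
    unfolding C_def using idx by (intro borel_measurable_times borel_measurable_const noisy_minor_measurable) blast
  have CA: "C j (merge ?A ?B (x, y)) = C j x" if "j < Suc m" for j x y
    unfolding C_def using idx[OF that]
    by (intro arg_cong2[where f = "(*)"] refl noisy_minor_cong) (auto simp: merge_def)
  have Cq: "(\<lambda>x. ennreal ((cmod (C j x))\<^sup>2)) \<in> borel_measurable ?P" if "j < Suc m" for j
    using CmA[OF that] by measurable
  have nC: "cmod (C j x) = cmod (noisy_minor \<mu> \<delta> x (Suc s) m (\<kappa> \<circ> insert_index j))" for j x
    by (simp add: C_def norm_mult norm_power)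
  have IH: "(\<integral>\<^sup>+ x. ennreal ((cmod (C j x))\<^sup>2) \<partial>?P) \<le> ennreal p" if "j < Suc m" for j
    unfolding nC p_def by (rule Suc.IH[OF cols[OF that]])
  have diag: "(cmod (\<Sum>j<Suc m. \<mu> (s, \<kappa> j) * C j x))\<^sup>2 = (\<Sum>j<Suc m. (cmod (\<mu> (s, \<kappa> j)))\<^sup>2 * (cmod (C j x))\<^sup>2)"
    and musum: "(\<Sum>j<Suc m. (cmod (\<mu> (s, \<kappa> j)))\<^sup>2) \<le> (\<sigma> s)\<^sup>2" for x
  proof -
    have "(cmod (\<Sum>j<Suc m. \<mu> (s, \<kappa> j) * C j x))\<^sup>2 = (\<Sum>j<Suc m. (cmod (\<mu> (s, \<kappa> j)))\<^sup>2 * (cmod (C j x))\<^sup>2)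
      \<and> (\<Sum>j<Suc m. (cmod (\<mu> (s, \<kappa> j)))\<^sup>2) \<le> (\<sigma> s)\<^sup>2"
    proof (cases "\<exists>j0<Suc m. \<kappa> j0 = s")
      case True
      then obtain j0 where j0: "j0 < Suc m" "\<kappa> j0 = s" by blast
      have z: "\<mu> (s, \<kappa> j) = (if j = j0 then complex_of_real (\<sigma> s) else 0)" if "j < Suc m" for j
        using Suc.prems(1) j0 that by (auto simp: \<mu>_def inj_on_def)
      have "(\<Sum>j<Suc m. \<mu> (s, \<kappa> j) * C j x) = (\<Sum>j<Suc m. if j = j0 then complex_of_real (\<sigma> s) * C j x else 0)"
        by (intro sum.cong) (auto simp: z)
      moreover have "(\<Sum>j<Suc m. (cmod (\<mu> (s, \<kappa> j)))\<^sup>2 * (cmod (C j x))\<^sup>2) = (\<Sum>j<Suc m. if j = j0 then (\<sigma> s)\<^sup>2 * (cmod (C j x))\<^sup>2 else 0)"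
        by (intro sum.cong) (auto simp: z)
      moreover have "(\<Sum>j<Suc m. (cmod (\<mu> (s, \<kappa> j)))\<^sup>2) = (\<Sum>j<Suc m. if j = j0 then (\<sigma> s)\<^sup>2 else 0)"
        by (intro sum.cong) (auto simp: z)
      ultimately show ?thesis using j0 by (simp only: sum.delta finite_lessThan) (auto simp: norm_mult power_mult_distrib)
    next
      case False
      then have "\<mu> (s, \<kappa> j) = 0" if "j < Suc m" for j using that by (auto simp: \<mu>_def)
      then show ?thesis by simp
    qed
    then show "(cmod (\<Sum>j<Suc m. \<mu> (s, \<kappa> j) * C j x))\<^sup>2 = (\<Sum>j<Suc m. (cmod (\<mu> (s, \<kappa> j)))\<^sup>2 * (cmod (C j x))\<^sup>2)"
      "(\<Sum>j<Suc m. (cmod (\<mu> (s, \<kappa> j)))\<^sup>2) \<le> (\<sigma> s)\<^sup>2" by auto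
  qed
  have "(\<integral>\<^sup>+ x. ennreal ((cmod (noisy_minor \<mu> \<delta> x s (Suc m) \<kappa>))\<^sup>2) \<partial>Pi\<^sub>M ({s..<s + Suc m} \<times> {..<n}) (\<lambda>_. complex_gaussian))
     = (\<integral>\<^sup>+ x. ennreal ((cmod (\<Sum>j<Suc m. (\<mu> (s, \<kappa> j) + complex_of_real \<delta> * x (s, \<kappa> j)) * C j x))\<^sup>2) \<partial>Pi\<^sub>M (?A \<union> ?B) (\<lambda>_. complex_gaussian))"
    unfolding AB noisy_minor_expand_first_row C_def ..
  also have "\<dots> = (\<integral>\<^sup>+ x. \<integral>\<^sup>+ g. ennreal ((cmod ((\<Sum>j<Suc m. \<mu> (s, \<kappa> j) * C j x)
        + complex_of_real (\<bar>\<delta>\<bar> * sqrt (\<Sum>j<Suc m. (cmod (C j x))\<^sup>2)) * g))\<^sup>2) \<partial>complex_gaussian \<partial>?P)"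
    using Suc.prems
    by (intro integrate_out_row[of ?A ?B "\<lambda>w. ennreal ((cmod w)\<^sup>2)" "\<lambda>j. (s, \<kappa> j)" "Suc m" C "\<lambda>j. \<mu> (s, \<kappa> j)"] Cm CA)
       (auto simp: inj_on_def image_subset_iff)
  also have "\<dots> = (\<integral>\<^sup>+ x. (\<Sum>j<Suc m. ennreal ((cmod (\<mu> (s, \<kappa> j)))\<^sup>2 + \<delta>\<^sup>2) * ennreal ((cmod (C j x))\<^sup>2)) \<partial>?P)"
  proof (intro nn_integral_cong, subst complex_gaussian_second_moment_affine)
    fix x
    have "(cmod (complex_of_real (\<bar>\<delta>\<bar> * sqrt (\<Sum>j<Suc m. (cmod (C j x))\<^sup>2))))\<^sup>2 = \<delta>\<^sup>2 * (\<Sum>j<Suc m. (cmod (C j x))\<^sup>2)"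
      unfolding norm_of_real power2_abs by (simp only: power_mult_distrib power2_abs) (simp add: sum_nonneg del: sum.lessThan_Suc)
    then have "(cmod (\<Sum>j<Suc m. \<mu> (s, \<kappa> j) * C j x))\<^sup>2 + (cmod (complex_of_real (\<bar>\<delta>\<bar> * sqrt (\<Sum>j<Suc m. (cmod (C j x))\<^sup>2))))\<^sup>2
        = (\<Sum>j<Suc m. ((cmod (\<mu> (s, \<kappa> j)))\<^sup>2 + \<delta>\<^sup>2) * (cmod (C j x))\<^sup>2)"
      unfolding diag by (simp only: distrib_right sum.distrib sum_distrib_left)
    then show "ennreal ((cmod (\<Sum>j<Suc m. \<mu> (s, \<kappa> j) * C j x))\<^sup>2 + (cmod (complex_of_real (\<bar>\<delta>\<bar> * sqrt (\<Sum>j<Suc m. (cmod (C j x))\<^sup>2))))\<^sup>2)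
        = (\<Sum>j<Suc m. ennreal ((cmod (\<mu> (s, \<kappa> j)))\<^sup>2 + \<delta>\<^sup>2) * ennreal ((cmod (C j x))\<^sup>2))"
      by (simp only: ennreal_mult[symmetric] zero_le_power2 add_nonneg_nonneg) (subst sum_ennreal, auto)
  qed
  also have "\<dots> = (\<Sum>j<Suc m. ennreal ((cmod (\<mu> (s, \<kappa> j)))\<^sup>2 + \<delta>\<^sup>2) * (\<integral>\<^sup>+ x. ennreal ((cmod (C j x))\<^sup>2) \<partial>?P))"
  proof (subst nn_integral_sum)
    show "(\<lambda>x. ennreal ((cmod (\<mu> (s, \<kappa> j)))\<^sup>2 + \<delta>\<^sup>2) * ennreal ((cmod (C j x))\<^sup>2)) \<in> borel_measurable ?P"
      if "j \<in> {..<Suc m}" for j using that by (intro borel_measurable_times_ennreal borel_measurable_const Cq) simp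
  qed (intro sum.cong refl nn_integral_cmult Cq, simp)
  also have "\<dots> \<le> (\<Sum>j<Suc m. ennreal ((cmod (\<mu> (s, \<kappa> j)))\<^sup>2 + \<delta>\<^sup>2) * ennreal p)"
    by (intro sum_mono mult_left_mono IH) auto
  also have "\<dots> = ennreal ((\<Sum>j<Suc m. (cmod (\<mu> (s, \<kappa> j)))\<^sup>2 + \<delta>\<^sup>2) * p)"
    unfolding sum_distrib_right using p0
    by (subst sum_ennreal[symmetric]) (auto simp: ennreal_mult simp del: sum.lessThan_Suc)
  also have "\<dots> \<le> ennreal (((\<sigma> s)\<^sup>2 + \<delta>\<^sup>2 * Suc m) * p)"
  proof (intro ennreal_leI mult_right_mono p0)
    show "(\<Sum>j<Suc m. (cmod (\<mu> (s, \<kappa> j)))\<^sup>2 + \<delta>\<^sup>2) \<le> (\<sigma> s)\<^sup>2 + \<delta>\<^sup>2 * Suc m"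
      using musum by (simp only: sum.distrib sum_constant card_lessThan) (simp add: mult.commute del: sum.lessThan_Suc)
  qed
  also have "((\<sigma> s)\<^sup>2 + \<delta>\<^sup>2 * Suc m) * p = (\<Prod>i<Suc m. (\<sigma> (s + i))\<^sup>2 + \<delta>\<^sup>2 * (Suc m - i))"
    unfolding p_def by (subst prod.lessThan_Suc_shift) simp
  finally show ?case .
qed

text \<open>Jensen's inequality for the logarithm, by its tangent at the mean \<open>M\<close>.\<close>

lemma ln_sum_ge_average:
  fixes y :: "nat \<Rightarrow> real"
  assumes y: "\<And>j. j < k \<Longrightarrow> y j \<ge> 0" and k: "k > 0"
  shows "(\<Sum>j<k. ln (1 + k * y j)) / k \<le> ln (1 + (\<Sum>j<k. y j))"
proof -
  define M where "M = 1 + (\<Sum>j<k. y j)"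
  have M: "M > 0" using y by (auto simp: M_def intro!: add_pos_nonneg sum_nonneg)
  have "ln (1 + k * y j) \<le> ln M + ((1 + k * y j) / M - 1)" if "j < k" for j
  proof -
    have pos: "1 + k * y j > 0" using y[OF that] by (intro add_pos_nonneg) auto
    have "ln ((1 + k * y j) / M) \<le> (1 + k * y j) / M - 1" using pos M by (intro ln_le_minus_one) auto
    then show ?thesis using pos M by (simp add: ln_div)
  qed
  then have "(\<Sum>j<k. ln (1 + k * y j)) \<le> (\<Sum>j<k. ln M + ((1 + k * y j) / M - 1))"
    by (intro sum_mono) auto
  also have "\<dots> = k * ln M + ((\<Sum>j<k. 1 + k * y j) / M - k)"
    by (simp only: sum.distrib sum_subtractf sum_divide_distrib[symmetric] sum_constant card_lessThan)
  also have "(\<Sum>j<k. 1 + k * y j) = k * M"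
    by (simp add: sum.distrib sum_distrib_left M_def distrib_left)
  also have "k * ln M + (k * M / M - k) = k * ln M" using M by simp
  finally show ?thesis using k by (simp add: M_def divide_le_eq mult.commute)
qed

text \<open>The mean \<open>\<mu>\<close> is arbitrary, because the loss in each step does not depend on the shift. Expanding along the last row, the determinant is a shifted
  Gaussian with variance \<open>\<delta>\<^sup>2 \<Sum>\<^sub>j \<bar>C\<^sub>j\<bar>\<^sup>2\<close>, where the \<open>k\<close> cofactors
  \<open>C\<^sub>j\<close> are minors of order \<open>k - 1\<close>. By concavity, the logarithm of this sum is at least
  \<open>log k\<close> plus the average of the logarithms of the \<open>\<bar>C\<^sub>j\<bar>\<^sup>2\<close>, so that each step gains a factor
  \<open>\<delta>\<^sup>2 k\<close> under the logarithm and loses the constant \<open>shift_loss\<close>. The parameter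
  \<open>t\<close> is rescaled in each step and must be general.\<close>

lemma noisy_minor_log_lower_bound:
  assumes "\<delta> > 0" "t > 0" "inj_on \<kappa> {..<k}" "\<kappa> ` {..<k} \<subseteq> {..<n}"
  shows "ennreal (ln (1 + t * (\<delta>\<^sup>2) ^ k * fact k) / 2)
    \<le> (\<integral>\<^sup>+ x. ennreal (smooth_log t (noisy_minor \<mu> \<delta> x 0 k \<kappa>)) \<partial>Pi\<^sub>M ({..<k} \<times> {..<n}) (\<lambda>_. complex_gaussian))
      + ennreal (k * shift_loss)"
  using assms(2-4)
proof (induction k arbitrary: t \<kappa>)
  case 0
  interpret prob_space complex_gaussian by (rule prob_space_complex_gaussian)
  show ?case by (simp add: PiM_empty nn_integral_count_space_finite smooth_log_def)
next
  case (Suc k)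
  interpret cg: prob_space complex_gaussian by (rule prob_space_complex_gaussian)
  let ?A = "{..<k} \<times> {..<n}" and ?B = "{k} \<times> {..<n}"
  let ?P = "Pi\<^sub>M ?A (\<lambda>_. complex_gaussian)"
  interpret P: prob_space ?P by (intro prob_space_PiM prob_space_complex_gaussian)
  define C where "C j x = (-1) ^ (k + j) * noisy_minor \<mu> \<delta> x 0 k (\<kappa> \<circ> insert_index j)" for j x
  have AB: "{..<Suc k} \<times> {..<n} = ?A \<union> ?B" by auto
  note cols = insert_index_cols[OF Suc.prems(2,3)]
  have idx: "(0 + i, (\<kappa> \<circ> insert_index j) l) \<in> ?A" if "j < Suc k" "i < k" "l < k" for i j l
    using cols(2)[OF that(1)] that by (auto simp: image_subset_iff)
  have Cm: "C j \<in> borel_measurable (Pi\<^sub>M (?A \<union> ?B) (\<lambda>_. complex_gaussian))" if "j < Suc k" for j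
    unfolding C_def using idx[OF that] by (intro borel_measurable_times borel_measurable_const noisy_minor_measurable) blast
  have CmA [measurable]: "j < Suc k \<Longrightarrow> C j \<in> borel_measurable ?P" for j
    unfolding C_def using idx by (intro borel_measurable_times borel_measurable_const noisy_minor_measurable) blast
  have CA: "C j (merge ?A ?B (x, y)) = C j x" if "j < Suc k" for j x y
    unfolding C_def using idx[OF that]
    by (intro arg_cong2[where f = "(*)"] refl noisy_minor_cong) (auto simp: merge_def)
  \<comment> \<open>this scale turns the average over the cofactors into one over smoothed logarithms\<close>
  define t' where "t' = t * \<delta>\<^sup>2 * Suc k"
  have t': "t' > 0" using Suc.prems(1) assms(1) by (simp add: t'_def)
  have hC: "smooth_log t' (C j x) = smooth_log t' (noisy_minor \<mu> \<delta> x 0 k (\<kappa> \<circ> insert_index j))" for j x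
    by (simp add: C_def smooth_log_mult norm_power)
  let ?goal = "ln (1 + t * (\<delta>\<^sup>2) ^ Suc k * fact (Suc k)) / 2"
  have g0: "?goal \<ge> 0" using Suc.prems(1) by simp
  have goal_eq: "t * (\<delta>\<^sup>2) ^ Suc k * fact (Suc k) = t' * (\<delta>\<^sup>2) ^ k * fact k" by (simp add: t'_def)
  have Cq: "(\<lambda>x. ennreal (smooth_log t' (C j x))) \<in> borel_measurable ?P" if "j < Suc k" for j
    using CmA[OF that] by measurable
  have IH: "ennreal ?goal \<le> (\<integral>\<^sup>+ x. ennreal (smooth_log t' (C j x)) \<partial>?P) + ennreal (k * shift_loss)" if "j < Suc k" for j
    unfolding hC goal_eq by (rule Suc.IH[OF t' cols[OF that]])
  let ?r = "inverse (real (Suc k))"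
  have r1: "(\<Sum>j<Suc k. ennreal ?r * c) = c" for c
  proof -
    have "(\<Sum>j<Suc k. ennreal ?r * c) = (of_nat (Suc k) * ennreal ?r) * c" by (simp add: mult.assoc del: sum.lessThan_Suc)
    also have "of_nat (Suc k) * ennreal ?r = 1"
      by (subst ennreal_of_nat_eq_real_of_nat, subst ennreal_mult[symmetric]) (simp_all del: of_nat_Suc)
    finally show ?thesis by simp
  qed
  have row: "(\<Sum>j<Suc k. ennreal ?r * ennreal (smooth_log t' (C j x)))
     \<le> (\<integral>\<^sup>+ g. ennreal (smooth_log t ((\<Sum>j<Suc k. \<mu> (k, \<kappa> j) * C j x)
        + complex_of_real (\<bar>\<delta>\<bar> * sqrt (\<Sum>j<Suc k. (cmod (C j x))\<^sup>2)) * g)) \<partial>complex_gaussian) + ennreal shift_loss" for x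
  proof -
    have arg: "t' * c = real (Suc k) * (t * \<delta>\<^sup>2 * c)" for c by (simp add: t'_def mult_ac)
    have s: "(\<bar>\<delta>\<bar> * sqrt (\<Sum>j<Suc k. (cmod (C j x))\<^sup>2))\<^sup>2 = \<delta>\<^sup>2 * (\<Sum>j<Suc k. (cmod (C j x))\<^sup>2)"
      by (simp only: power_mult_distrib power2_abs) (simp add: sum_nonneg del: sum.lessThan_Suc)
    have "(\<Sum>j<Suc k. ennreal ?r * ennreal (smooth_log t' (C j x))) = (\<Sum>j<Suc k. ennreal (?r * smooth_log t' (C j x)))"
      using t' by (intro sum.cong refl ennreal_mult[symmetric]) (auto simp: smooth_log_nonneg)
    also have "\<dots> = ennreal (\<Sum>j<Suc k. ?r * smooth_log t' (C j x))"
      using t' by (intro sum_ennreal) (auto simp: smooth_log_nonneg)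
    also have "(\<Sum>j<Suc k. ?r * smooth_log t' (C j x))
        = ((\<Sum>j<Suc k. ln (1 + Suc k * (t * \<delta>\<^sup>2 * (cmod (C j x))\<^sup>2))) / Suc k) / 2"
      unfolding smooth_log_def arg sum_divide_distrib
      by (simp only: divide_inverse mult_ac)
    also have "ennreal \<dots> \<le> ennreal (ln (1 + (\<Sum>j<Suc k. t * \<delta>\<^sup>2 * (cmod (C j x))\<^sup>2)) / 2)"
      using Suc.prems(1) by (intro ennreal_leI divide_right_mono ln_sum_ge_average) auto
    also have "(\<Sum>j<Suc k. t * \<delta>\<^sup>2 * (cmod (C j x))\<^sup>2) = t * (\<bar>\<delta>\<bar> * sqrt (\<Sum>j<Suc k. (cmod (C j x))\<^sup>2))\<^sup>2"
      unfolding s by (simp add: sum_distrib_left mult.assoc del: sum.lessThan_Suc)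
    also have "ennreal (ln (1 + \<dots>) / 2) \<le> (\<integral>\<^sup>+ g. ennreal (smooth_log t ((\<Sum>j<Suc k. \<mu> (k, \<kappa> j) * C j x)
        + complex_of_real (\<bar>\<delta>\<bar> * sqrt (\<Sum>j<Suc k. (cmod (C j x))\<^sup>2)) * g)) \<partial>complex_gaussian) + ennreal shift_loss"
      by (intro complex_gaussian_smooth_log_ge_scale Suc.prems(1)) (simp add: sum_nonneg del: sum.lessThan_Suc)
    finally show ?thesis .
  qed
  have "ennreal ?goal = (\<Sum>j<Suc k. ennreal ?r * ennreal ?goal)" by (rule r1[symmetric])
  also have "\<dots> \<le> (\<Sum>j<Suc k. ennreal ?r * ((\<integral>\<^sup>+ x. ennreal (smooth_log t' (C j x)) \<partial>?P) + ennreal (k * shift_loss)))"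
    by (intro sum_mono mult_left_mono IH) auto
  also have "\<dots> = (\<Sum>j<Suc k. ennreal ?r * (\<integral>\<^sup>+ x. ennreal (smooth_log t' (C j x)) \<partial>?P)) + ennreal (k * shift_loss)"
    unfolding distrib_left sum.distrib r1 ..
  also have "(\<Sum>j<Suc k. ennreal ?r * (\<integral>\<^sup>+ x. ennreal (smooth_log t' (C j x)) \<partial>?P))
      = (\<integral>\<^sup>+ x. (\<Sum>j<Suc k. ennreal ?r * ennreal (smooth_log t' (C j x))) \<partial>?P)"
  proof (subst nn_integral_sum)
    show "(\<lambda>x. ennreal ?r * ennreal (smooth_log t' (C j x))) \<in> borel_measurable ?P"
      if "j \<in> {..<Suc k}" for j using that by (intro borel_measurable_times_ennreal borel_measurable_const Cq) simp
  qed (intro sum.cong refl nn_integral_cmult[symmetric] Cq, simp)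
  also have "\<dots> \<le> (\<integral>\<^sup>+ x. (\<integral>\<^sup>+ g. ennreal (smooth_log t ((\<Sum>j<Suc k. \<mu> (k, \<kappa> j) * C j x)
        + complex_of_real (\<bar>\<delta>\<bar> * sqrt (\<Sum>j<Suc k. (cmod (C j x))\<^sup>2)) * g)) \<partial>complex_gaussian) + ennreal shift_loss \<partial>?P)"
    by (intro nn_integral_mono row)
  also have "\<dots> = (\<integral>\<^sup>+ x. (\<integral>\<^sup>+ g. ennreal (smooth_log t ((\<Sum>j<Suc k. \<mu> (k, \<kappa> j) * C j x)
        + complex_of_real (\<bar>\<delta>\<bar> * sqrt (\<Sum>j<Suc k. (cmod (C j x))\<^sup>2)) * g)) \<partial>complex_gaussian) \<partial>?P) + ennreal shift_loss"
  proof (subst nn_integral_add)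
    show "(\<lambda>x. \<integral>\<^sup>+ g. ennreal (smooth_log t ((\<Sum>j<Suc k. \<mu> (k, \<kappa> j) * C j x)
        + complex_of_real (\<bar>\<delta>\<bar> * sqrt (\<Sum>j<Suc k. (cmod (C j x))\<^sup>2)) * g)) \<partial>complex_gaussian) \<in> borel_measurable ?P"
      by (rule cg.borel_measurable_nn_integral) measurable
  qed (use P.emeasure_space_1 in auto)
  also have "(\<integral>\<^sup>+ x. (\<integral>\<^sup>+ g. ennreal (smooth_log t ((\<Sum>j<Suc k. \<mu> (k, \<kappa> j) * C j x)
        + complex_of_real (\<bar>\<delta>\<bar> * sqrt (\<Sum>j<Suc k. (cmod (C j x))\<^sup>2)) * g)) \<partial>complex_gaussian) \<partial>?P)
     = (\<integral>\<^sup>+ x. ennreal (smooth_log t (\<Sum>j<Suc k. (\<mu> (k, \<kappa> j) + complex_of_real \<delta> * x (k, \<kappa> j)) * C j x)) \<partial>Pi\<^sub>M (?A \<union> ?B) (\<lambda>_. complex_gaussian))"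
    using Suc.prems
    by (intro integrate_out_row[symmetric, of ?A ?B "\<lambda>w. ennreal (smooth_log t w)" "\<lambda>j. (k, \<kappa> j)" "Suc k" C "\<lambda>j. \<mu> (k, \<kappa> j)"] Cm CA)
       (auto simp: inj_on_def image_subset_iff)
  also have "\<dots> = (\<integral>\<^sup>+ x. ennreal (smooth_log t (noisy_minor \<mu> \<delta> x 0 (Suc k) \<kappa>)) \<partial>Pi\<^sub>M ({..<Suc k} \<times> {..<n}) (\<lambda>_. complex_gaussian))"
    unfolding AB noisy_minor_expand_last_row C_def add_0 ..
  finally have "ennreal ?goal \<le> (\<integral>\<^sup>+ x. ennreal (smooth_log t (noisy_minor \<mu> \<delta> x 0 (Suc k) \<kappa>)) \<partial>Pi\<^sub>M ({..<Suc k} \<times> {..<n}) (\<lambda>_. complex_gaussian))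
      + (ennreal shift_loss + ennreal (k * shift_loss))" by (simp only: add.assoc add_right_mono)
  also have "ennreal shift_loss + ennreal (k * shift_loss) = ennreal (Suc k * shift_loss)"
    using shift_loss_nonneg by (subst ennreal_plus[symmetric]) (auto simp: algebra_simps)
  finally show ?case .
qed

text \<open>The last row and column are removed at no loss: by the sub-mean value property the expectation over the last row is
  at least the value without noise in that row, which is \<open>\<sigma>\<^sub>m\<close> times the leading minor of order
  \<open>m\<close>. Once only \<open>k\<close> rows are left, the previous bound takes over.\<close>

lemma noisy_diag_log_lower_bound:
  fixes \<sigma> :: "nat \<Rightarrow> real"
  defines "\<mu> \<equiv> \<lambda>(i, j). if i = j then complex_of_real (\<sigma> i) else 0"
  assumes \<delta>: "\<delta> > 0" and t: "t > 0" and km: "k \<le> m" and mn: "m \<le> n"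
    and \<sigma>: "\<And>i. k \<le> i \<Longrightarrow> i < m \<Longrightarrow> \<sigma> i > 0"
  shows "ennreal (ln (1 + t * ((\<delta>\<^sup>2) ^ k * fact k * (\<Prod>i=k..<m. (\<sigma> i)\<^sup>2))) / 2)
    \<le> (\<integral>\<^sup>+ x. ennreal (smooth_log t (noisy_minor \<mu> \<delta> x 0 m id)) \<partial>Pi\<^sub>M ({..<m} \<times> {..<n}) (\<lambda>_. complex_gaussian))
      + ennreal (k * shift_loss)"
  using km mn \<sigma> t
proof (induction m arbitrary: t rule: dec_induct)
  case base
  then have "inj_on id {..<k}" "id ` {..<k} \<subseteq> {..<n}" "t > 0" by auto
  from noisy_minor_log_lower_bound[OF \<delta> this(3,1,2)] show ?case
    by (simp only: mult.assoc atLeastLessThan_empty[OF order_refl] prod.empty mult_1_right)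
next
  case (step m)
  interpret cg: prob_space complex_gaussian by (rule prob_space_complex_gaussian)
  let ?A = "{..<m} \<times> {..<n}" and ?B = "{m} \<times> {..<n}"
  let ?P = "Pi\<^sub>M ?A (\<lambda>_. complex_gaussian)"
  define C where "C j x = (-1) ^ (m + j) * noisy_minor \<mu> \<delta> x 0 m (id \<circ> insert_index j)" for j x
  have AB: "{..<Suc m} \<times> {..<n} = ?A \<union> ?B" by auto
  have cols: "inj_on (id \<circ> insert_index j) {..<m}" "(id \<circ> insert_index j) ` {..<m} \<subseteq> {..<n}" if "j < Suc m" for j
    using insert_index_cols[of id m "{..<n}" j] that step.prems by auto
  have idx: "(0 + i, (id \<circ> insert_index j) l) \<in> ?A" if "j < Suc m" "i < m" "l < m" for i j l
    using cols(2)[OF that(1)] that by (auto simp: image_subset_iff)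
  have Cm: "C j \<in> borel_measurable (Pi\<^sub>M (?A \<union> ?B) (\<lambda>_. complex_gaussian))" if "j < Suc m" for j
    unfolding C_def using idx[OF that] by (intro borel_measurable_times borel_measurable_const noisy_minor_measurable) blast
  have CA: "C j (merge ?A ?B (x, y)) = C j x" if "j < Suc m" for j x y
    unfolding C_def using idx[OF that]
    by (intro arg_cong2[where f = "(*)"] refl noisy_minor_cong) (auto simp: merge_def)
  define t' where "t' = t * (\<sigma> m)\<^sup>2"
  have \<sigma>m: "\<sigma> m > 0" using step by auto
  have t': "t' > 0" using step.prems \<sigma>m by (simp add: t'_def)
  have "(\<Sum>j<Suc m. \<mu> (m, id j) * C j x) = complex_of_real (\<sigma> m) * noisy_minor \<mu> \<delta> x 0 m id" for x
  proof -
    have "(\<Sum>j<Suc m. \<mu> (m, id j) * C j x) = complex_of_real (\<sigma> m) * C m x"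
      by (simp add: \<mu>_def)
    also have "C m x = noisy_minor \<mu> \<delta> x 0 m (id \<circ> insert_index m)" by (simp add: C_def)
    also have "\<dots> = noisy_minor \<mu> \<delta> x 0 m id" by (rule noisy_minor_cong_cols) simp
    finally show ?thesis .
  qed
  then have h: "smooth_log t (\<Sum>j<Suc m. \<mu> (m, id j) * C j x) = smooth_log t' (noisy_minor \<mu> \<delta> x 0 m id)" for x
    by (simp add: smooth_log_mult t'_def)
  have "t * ((\<delta>\<^sup>2) ^ k * fact k * (\<Prod>i=k..<Suc m. (\<sigma> i)\<^sup>2)) = t' * ((\<delta>\<^sup>2) ^ k * fact k * (\<Prod>i=k..<m. (\<sigma> i)\<^sup>2))"
    using step.hyps by (simp add: t'_def)
  moreover have "m \<le> n" "\<And>i. k \<le> i \<Longrightarrow> i < m \<Longrightarrow> \<sigma> i > 0" using step.prems by auto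
  note step.IH[OF this t']
  ultimately have IH: "ennreal (ln (1 + t * ((\<delta>\<^sup>2) ^ k * fact k * (\<Prod>i=k..<Suc m. (\<sigma> i)\<^sup>2))) / 2)
     \<le> (\<integral>\<^sup>+ x. ennreal (smooth_log t' (noisy_minor \<mu> \<delta> x 0 m id)) \<partial>?P) + ennreal (k * shift_loss)"
    by (simp only:)
  have "(\<integral>\<^sup>+ x. ennreal (smooth_log t' (noisy_minor \<mu> \<delta> x 0 m id)) \<partial>?P)
      \<le> (\<integral>\<^sup>+ x. \<integral>\<^sup>+ g. ennreal (smooth_log t ((\<Sum>j<Suc m. \<mu> (m, id j) * C j x)
        + complex_of_real (\<bar>\<delta>\<bar> * sqrt (\<Sum>j<Suc m. (cmod (C j x))\<^sup>2)) * g)) \<partial>complex_gaussian \<partial>?P)"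
    unfolding h[symmetric] using step.prems by (intro nn_integral_mono complex_gaussian_smooth_log_ge)
  also have "\<dots> = (\<integral>\<^sup>+ x. ennreal (smooth_log t (\<Sum>j<Suc m. (\<mu> (m, id j) + complex_of_real \<delta> * x (m, id j)) * C j x)) \<partial>Pi\<^sub>M (?A \<union> ?B) (\<lambda>_. complex_gaussian))"
    using step.prems
    by (intro integrate_out_row[symmetric, of ?A ?B "\<lambda>w. ennreal (smooth_log t w)" "\<lambda>j. (m, id j)" "Suc m" C "\<lambda>j. \<mu> (m, id j)"] Cm CA)
       (auto simp: inj_on_def image_subset_iff)
  also have "\<dots> = (\<integral>\<^sup>+ x. ennreal (smooth_log t (noisy_minor \<mu> \<delta> x 0 (Suc m) id)) \<partial>Pi\<^sub>M ({..<Suc m} \<times> {..<n}) (\<lambda>_. complex_gaussian))"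
    unfolding AB noisy_minor_expand_last_row C_def add_0 ..
  finally show ?case by (rule order_trans[OF IH add_right_mono])
qed

section \<open>Singular values and the threshold index\<close>

text \<open>For an eigenvector \<open>v\<close>, \<open>x \<parallel>v\<parallel>\<^sup>2 = \<parallel>A v\<parallel>\<^sup>2\<close>.\<close>

lemma eigenvalue_adjoint_mult_self_nonneg:
  fixes A :: "complex mat"
  assumes A: "A \<in> carrier_mat n n" and ev: "eigenvalue (mat_adjoint A * A) x"
  shows "Re x \<ge> 0"
proof -
  have adj: "mat_adjoint A \<in> carrier_mat n n" using A by (auto simp: mat_adjoint_def)
  have entry: "mat_adjoint A $$ (i, j) = cnj (A $$ (j, i))" if "i < n" "j < n" for i j
    using A that by (simp add: mat_adjoint_def mat_of_rows_def)
  obtain v where v: "v \<in> carrier_vec n" "v \<noteq> 0\<^sub>v n" "(mat_adjoint A * A) *\<^sub>v v = x \<cdot>\<^sub>v v"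
    using ev A adj unfolding eigenvalue_def eigenvector_def by auto
  define w where "w = A *\<^sub>v v"
  have w: "w \<in> carrier_vec n" using A v by (simp add: w_def)
  have eq: "mat_adjoint A *\<^sub>v w = x \<cdot>\<^sub>v v"
    using v(3) A adj v(1) by (simp add: w_def)
  have row: "x * v $ i = (\<Sum>j<n. cnj (A $$ (j, i)) * w $ j)" if i: "i < n" for i
  proof -
    have "(mat_adjoint A *\<^sub>v w) $ i = (\<Sum>j<n. cnj (A $$ (j, i)) * w $ j)"
      using adj w i entry by (auto simp: scalar_prod_def atLeast0LessThan intro!: sum.cong)
    then show ?thesis using v(1) i by (simp add: eq)
  qed
  have wj: "w $ j = (\<Sum>i<n. A $$ (j, i) * v $ i)" if "j < n" for j
    using A v(1) that by (auto simp: w_def scalar_prod_def atLeast0LessThan intro!: sum.cong)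
  have "x * (\<Sum>i<n. cnj (v $ i) * v $ i) = (\<Sum>i<n. cnj (v $ i) * (x * v $ i))"
    by (simp add: sum_distrib_left mult_ac)
  also have "\<dots> = (\<Sum>i<n. \<Sum>j<n. cnj (v $ i) * (cnj (A $$ (j, i)) * w $ j))"
    by (intro sum.cong refl) (simp add: row sum_distrib_left)
  also have "\<dots> = (\<Sum>j<n. \<Sum>i<n. cnj (v $ i) * (cnj (A $$ (j, i)) * w $ j))" by (rule sum.swap)
  also have "\<dots> = (\<Sum>j<n. cnj (w $ j) * w $ j)"
    by (intro sum.cong refl) (simp add: wj sum_distrib_left sum_distrib_right mult_ac)
  finally have key: "x * (\<Sum>i<n. cnj (v $ i) * v $ i) = (\<Sum>j<n. cnj (w $ j) * w $ j)" .
  have nrm: "(\<Sum>i<n. cnj (y i) * y i) = complex_of_real (\<Sum>i<n. (cmod (y i))\<^sup>2)" for y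
    by (simp only: of_real_sum complex_norm_square mult.commute)
  obtain i0 where i0: "i0 < n" "v $ i0 \<noteq> 0" using v(1,2) by (metis eq_vecI carrier_vecD index_zero_vec(1) index_zero_vec(2))
  have pos: "(\<Sum>i<n. (cmod (v $ i))\<^sup>2) > 0"
    using i0 by (intro sum_pos2[of _ i0]) auto
  have "Re (x * complex_of_real r) = Re x * r" for r by simp
  from this[of "\<Sum>i<n. (cmod (v $ i))\<^sup>2"]
  have "Re x * (\<Sum>i<n. (cmod (v $ i))\<^sup>2) = (\<Sum>j<n. (cmod (w $ j))\<^sup>2)"
    using key unfolding nrm by (simp only: Re_complex_of_real)
  then have "Re x * (\<Sum>i<n. (cmod (v $ i))\<^sup>2) \<ge> 0" by (simp add: sum_nonneg)
  then show ?thesis using pos by (simp add: zero_le_mult_iff)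
qed

lemma
  fixes A :: "complex mat"
  assumes A: "A \<in> carrier_mat n n"
  shows length_singular_values: "length (singular_values A) = n"
    and sing_val_nonneg: "1 \<le> i \<Longrightarrow> i \<le> n \<Longrightarrow> sing_val A i \<ge> 0"
    and sing_val_mono: "1 \<le> i \<Longrightarrow> i \<le> j \<Longrightarrow> j \<le> n \<Longrightarrow> sing_val A i \<le> sing_val A j"
proof -
  let ?B = "mat_adjoint A * A"
  have B: "?B \<in> carrier_mat n n" using A by (auto simp: mat_adjoint_def)
  have "size (proots (char_poly ?B)) = n"
    using degree_monic_char_poly[OF B] by (simp add: size_proots_complex)
  then show len: "length (singular_values A) = n"
    unfolding singular_values_def by (metis mset_sorted_list_of_multiset size_image_mset size_mset)
  have nn: "y \<ge> 0" if y: "y \<in> set (singular_values A)" for y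
  proof -
    obtain x where x: "x \<in># proots (char_poly ?B)" "y = sqrt (Re x)"
      using y by (auto simp: singular_values_def)
    have "char_poly ?B \<noteq> 0" using degree_monic_char_poly[OF B] by (metis coeff_0 zero_neq_one)
    then have "eigenvalue ?B x" using x(1) eigenvalue_root_char_poly[OF B] by simp
    then show ?thesis using eigenvalue_adjoint_mult_self_nonneg[OF A] x(2) by simp
  qed
  show "sing_val A i \<ge> 0" if "1 \<le> i" "i \<le> n" 
    unfolding sing_val_def using that len by (intro nn nth_mem) auto
  show "sing_val A i \<le> sing_val A j" if "1 \<le> i" "i \<le> j" "j \<le> n"
    unfolding sing_val_def using that len
    by (intro sorted_nth_mono) (auto simp: singular_values_def)
qed

text \<open>Beyond \<open>N\<^sup>*\<close> the singular values are above the threshold. Up to \<open>N\<^sup>*\<close> they are, by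
  monotonicity, below the threshold at \<open>N\<^sup>*\<close>, except when no index satisfies the defining inequality;
  then \<open>N\<^sup>* = 1\<close>.\<close>

lemma N_star_properties:
  fixes \<gamma> \<epsilon> :: real
  assumes A: "A \<in> carrier_mat n n" and n: "n \<ge> 1"
  defines "k \<equiv> N_star \<gamma> \<epsilon> A"
  shows "1 \<le> k" "k \<le> n"
    and "k < i \<Longrightarrow> i \<le> n \<Longrightarrow> inverse \<epsilon> * real n powr (- \<gamma>) * sqrt (real n - real i + 1) \<le> sing_val A i"
    and "k = 1 \<or> (1 \<le> i \<longrightarrow> i \<le> k \<longrightarrow> sing_val A i \<le> inverse \<epsilon> * real n powr (- \<gamma>) * sqrt (real n - real k + 1))"
proof -
  define I where "I = {i \<in> {1..n}. sing_val A i < inverse \<epsilon> * real n powr (- \<gamma>) * sqrt (real n - real i + 1)}"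
  have k: "k = (if I = {} then 1 else Max I)"
    unfolding k_def N_star_def I_def Let_def using A by (simp only: carrier_matD)
  have fin: "finite I" by (simp add: I_def)
  have mem: "k \<in> I" if "I \<noteq> {}" using that fin by (simp add: k)
  show 1: "1 \<le> k" "k \<le> n" using mem n by (cases "I = {}"; auto simp: k I_def)+
  show "inverse \<epsilon> * real n powr (- \<gamma>) * sqrt (real n - real i + 1) \<le> sing_val A i" if "k < i" "i \<le> n"
  proof (rule ccontr)
    assume "\<not> ?thesis"
    then have "i \<in> I" using that 1 by (simp add: I_def)
    then have "i \<le> k" using fin by (auto simp: k)
    then show False using that by simp
  qed
  show "k = 1 \<or> (1 \<le> i \<longrightarrow> i \<le> k \<longrightarrow> sing_val A i \<le> inverse \<epsilon> * real n powr (- \<gamma>) * sqrt (real n - real k + 1))"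
  proof (cases "I = {}")
    case False
    then have "sing_val A k < inverse \<epsilon> * real n powr (- \<gamma>) * sqrt (real n - real k + 1)" using mem by (simp add: I_def)
    moreover have "sing_val A i \<le> sing_val A k" if "1 \<le> i" "i \<le> k" using sing_val_mono[OF A] that 1 by blast
    ultimately show ?thesis by fastforce
  qed (simp add: k)
qed

lemma det_B_mat:
  assumes A: "A \<in> carrier_mat n n"
  shows "Determinant.det (B_mat \<gamma> \<epsilon> A) = (\<Prod>i = N_star \<gamma> \<epsilon> A..<n. complex_of_real (sing_val A (i + 1)))"
proof -
  let ?k = "N_star \<gamma> \<epsilon> A"
  have B: "B_mat \<gamma> \<epsilon> A = Matrix.mat (n - ?k) (n - ?k) (\<lambda>(i, j). if i = j then complex_of_real (sing_val A (?k + i + 1)) else 0)"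
    using A by (intro eq_matI) (auto simp: B_mat_def lower_right_block_def Sigma_mat_def mat_diag_def)
  have "Determinant.det (B_mat \<gamma> \<epsilon> A) = prod_list (diag_mat (B_mat \<gamma> \<epsilon> A))"
    by (rule det_upper_triangular[of _ "n - ?k"]) (auto simp: B upper_triangular_def)
  also have "\<dots> = (\<Prod>i<n - ?k. complex_of_real (sing_val A (?k + i + 1)))"
    by (simp add: B prod_list_diag_prod atLeast0LessThan)
  also have "\<dots> = (\<Prod>i = ?k..<n. complex_of_real (sing_val A (i + 1)))"
    by (rule prod.reindex_bij_witness[of _ "\<lambda>i. i - ?k" "\<lambda>i. ?k + i"]) auto
  finally show ?thesis .
qed

lemma det_Sigma_mat_noise:
  assumes A: "A \<in> carrier_mat n n" and H: "H \<in> carrier_mat n n"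
  shows "Determinant.det (Sigma_mat A + complex_of_real \<delta> \<cdot>\<^sub>m H)
    = noisy_minor (\<lambda>(i, j). if i = j then complex_of_real (sing_val A (i + 1)) else 0) \<delta>
        (\<lambda>ij\<in>{..<n} \<times> {..<n}. H $$ ij) 0 n id"
  unfolding noisy_minor_def using A H
  by (intro arg_cong[where f = Determinant.det] eq_matI) (auto simp: Sigma_mat_def mat_diag_def)

section \<open>Deviation of the log-determinant in a fixed dimension\<close>

text \<open>Let \<open>W = log (\<bar>X\<bar>\<^sup>2 + 1/t) - 2 s\<close>. The second moment bounds the expectation of
  \<open>exp W\<close>, the logarithmic bound that of \<open>-W\<close>, and
  \<open>\<bar>W\<bar> \<le> 2 u + 2 exp (W - u) - W\<close> turns the two into a bound for the expectation of
  \<open>\<bar>W\<bar>\<close>; Markov's inequality does the rest. The event that \<open>X\<close> vanishes is covered: there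
  \<open>W\<close> is very negative.\<close>

lemma ln_deviation_bound:
  fixes X :: "'a \<Rightarrow> complex" and U L s r c :: real
  assumes P: "prob_space P"
    and X [measurable]: "X \<in> borel_measurable P"
    and U: "(\<integral>\<^sup>+ \<omega>. ennreal ((cmod (X \<omega>))\<^sup>2) \<partial>P) \<le> ennreal U" "U > 0"
    and L: "\<And>t. t > 0 \<Longrightarrow> ennreal (ln (1 + t * L) / 2) \<le> (\<integral>\<^sup>+ \<omega>. ennreal (smooth_log t (X \<omega>)) \<partial>P) + ennreal c"
      "L > 0" "c \<ge> 0"
    and u: "ln U - 2 * s \<le> u" "u \<ge> 0"
    and l: "2 * s - ln L \<le> l" "l \<ge> 0"
    and r: "r > 1/2"
  shows "measure P {\<omega> \<in> space P. \<bar>ln (cmod (X \<omega>)) - s\<bar> > r} \<le> (2 * u + l + 2 * c + 4) / (2 * r - 1)"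
proof -
  interpret prob_space P by (rule P)
  \<comment> \<open>large enough for \<open>1/t\<close> to be negligible both against the second moment and on the event that \<open>\<bar>X\<bar>\<close> is small\<close>
  define t where "t = 1 / min U (exp (2 * s - 2 * r))"
  have t: "t > 0" "1 / t \<le> U" "1 / t \<le> exp (2 * s - 2 * r)" using U(2) by (auto simp: t_def)
  define W where "W \<omega> = 2 * smooth_log t (X \<omega>) - ln t - 2 * s" for \<omega>
  have Wm [measurable]: "W \<in> borel_measurable P" unfolding W_def by measurable
  have Y: "exp (W \<omega>) = (1 / t + (cmod (X \<omega>))\<^sup>2) * exp (- 2 * s)" for \<omega>
  proof -
    have "1 + t * (cmod (X \<omega>))\<^sup>2 > 0" using t by (intro add_pos_nonneg) auto
    then have "W \<omega> = ln ((1 + t * (cmod (X \<omega>))\<^sup>2) / t) + (- 2 * s)"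
      and "(1 + t * (cmod (X \<omega>))\<^sup>2) / t > 0"
      using t(1) by (simp_all add: W_def smooth_log_def ln_div)
    from this(1) exp_ln[OF this(2)] have "exp (W \<omega>) = (1 + t * (cmod (X \<omega>))\<^sup>2) / t * exp (- 2 * s)"
      by (simp only: exp_add)
    also have "(1 + t * (cmod (X \<omega>))\<^sup>2) / t = 1 / t + (cmod (X \<omega>))\<^sup>2" using t(1) by (simp add: field_simps)
    finally show ?thesis .
  qed
  have intX: "integrable P (\<lambda>\<omega>. (cmod (X \<omega>))\<^sup>2)"
    using U(1) by (intro integrableI_bounded) (auto intro: le_less_trans)
  have EX: "(\<integral>\<omega>. (cmod (X \<omega>))\<^sup>2 \<partial>P) \<le> U"
    using U by (subst (asm) nn_integral_eq_integral[OF intX]) auto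
  have hX: "smooth_log t w \<le> t * (cmod w)\<^sup>2" for w
  proof -
    have "ln (1 + t * (cmod w)\<^sup>2) \<le> t * (cmod w)\<^sup>2" using t by (intro ln_add_one_self_le_self) auto
    moreover have "0 \<le> t * (cmod w)\<^sup>2" using t by simp
    ultimately show ?thesis unfolding smooth_log_def by linarith
  qed
  have inth: "integrable P (\<lambda>\<omega>. smooth_log t (X \<omega>))"
  proof (rule Bochner_Integration.integrable_bound)
    show "integrable P (\<lambda>\<omega>. t * (cmod (X \<omega>))\<^sup>2)" using intX by simp
    show "AE \<omega> in P. norm (smooth_log t (X \<omega>)) \<le> norm (t * (cmod (X \<omega>))\<^sup>2)"
      using t hX by (auto simp: smooth_log_nonneg)
  qed measurable
  have Eh: "ln (1 + t * L) / 2 - c \<le> (\<integral>\<omega>. smooth_log t (X \<omega>) \<partial>P)"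
  proof -
    have h0: "(\<integral>\<omega>. smooth_log t (X \<omega>) \<partial>P) \<ge> 0" using t by (intro Bochner_Integration.integral_nonneg) (auto simp: smooth_log_nonneg)
    have "(\<integral>\<^sup>+ \<omega>. ennreal (smooth_log t (X \<omega>)) \<partial>P) = ennreal (\<integral>\<omega>. smooth_log t (X \<omega>) \<partial>P)"
      using t by (intro nn_integral_eq_integral inth) (auto simp: smooth_log_nonneg)
    then have "ennreal (ln (1 + t * L) / 2) \<le> ennreal ((\<integral>\<omega>. smooth_log t (X \<omega>) \<partial>P) + c)"
      using L(1)[OF t(1)] h0 L(3) by simp
    then show ?thesis using h0 L(3) by (subst (asm) ennreal_le_iff) auto
  qed
  have EW: "- (\<integral>\<omega>. W \<omega> \<partial>P) \<le> l + 2 * c"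
  proof -
    have "(\<integral>\<omega>. W \<omega> \<partial>P) = 2 * (\<integral>\<omega>. smooth_log t (X \<omega>) \<partial>P) - ln t - 2 * s"
      unfolding W_def using inth by (simp add: prob_space)
    moreover have "ln (t * L) \<le> ln (1 + t * L)" using t L by (intro ln_mono) auto
    moreover have "ln (t * L) = ln t + ln L" using t L by (simp add: ln_mult)
    ultimately show ?thesis using Eh l by linarith
  qed
  have pt: "\<bar>W \<omega>\<bar> \<le> 2 * u + 2 * exp (W \<omega> - u) - W \<omega>" for \<omega>
  proof -
    have "W \<omega> - u \<le> exp (W \<omega> - u)" using exp_ge_add_one_self[of "W \<omega> - u"] by linarith
    moreover have "exp (W \<omega> - u) > 0" by simp
    ultimately show ?thesis using u(2) by linarith
  qed
  have intW: "integrable P W" unfolding W_def using inth by simp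
  have inte: "integrable P (\<lambda>\<omega>. exp (W \<omega> - u))"
    unfolding exp_diff Y using intX by simp
  have Ee: "(\<integral>\<omega>. exp (W \<omega> - u) \<partial>P) \<le> 2"
  proof -
    have "(\<integral>\<omega>. exp (W \<omega> - u) \<partial>P) = (1 / t + (\<integral>\<omega>. (cmod (X \<omega>))\<^sup>2 \<partial>P)) * exp (- 2 * s) / exp u"
      unfolding exp_diff Y using intX by (simp add: prob_space)
    also have "\<dots> \<le> (U + U) * exp (- 2 * s) / exp u"
      using t EX by (intro divide_right_mono mult_right_mono add_mono) auto
    also have "\<dots> = 2 * exp (ln U - 2 * s - u)"
    proof -
      have e: "ln U - 2 * s - u = ln U + (- 2 * s) - u" by simp
      show ?thesis unfolding e exp_diff exp_add exp_ln[OF U(2)] by simp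
    qed
    also have "\<dots> \<le> 2" using u by simp
    finally show ?thesis .
  qed
  have Eabs: "(\<integral>\<omega>. \<bar>W \<omega>\<bar> \<partial>P) \<le> 2 * u + l + 2 * c + 4"
  proof -
    have "(\<integral>\<omega>. \<bar>W \<omega>\<bar> \<partial>P) \<le> (\<integral>\<omega>. 2 * u + 2 * exp (W \<omega> - u) - W \<omega> \<partial>P)"
      using intW inte by (intro integral_mono pt) auto
    also have "\<dots> = 2 * u + 2 * (\<integral>\<omega>. exp (W \<omega> - u) \<partial>P) - (\<integral>\<omega>. W \<omega> \<partial>P)"
      using intW inte by (simp add: prob_space)
    finally show ?thesis using EW Ee by linarith
  qed
  have sub: "{\<omega> \<in> space P. \<bar>ln (cmod (X \<omega>)) - s\<bar> > r} \<subseteq> {\<omega> \<in> space P. 2 * r - 1 \<le> \<bar>W \<omega>\<bar>}"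
  proof clarify
    fix \<omega> assume \<omega>: "\<omega> \<in> space P" and dev: "\<bar>ln (cmod (X \<omega>)) - s\<bar> > r"
    have small: "2 * r - 1 \<le> \<bar>W \<omega>\<bar>" if "(cmod (X \<omega>))\<^sup>2 \<le> exp (2 * s - 2 * r)"
    proof -
      have "exp (W \<omega>) \<le> (exp (2 * s - 2 * r) + exp (2 * s - 2 * r)) * exp (- 2 * s)"
        unfolding Y using t that by (intro mult_right_mono add_mono) auto
      also have "\<dots> = 2 * exp (- 2 * r)" 
      proof -
        have "exp (2 * s - 2 * r) * exp (- 2 * s) = exp (- 2 * r)" by (simp add: mult_exp_exp)
        then show ?thesis by (simp only: distrib_right mult_2)
      qed
      also have "\<dots> \<le> exp 1 * exp (- 2 * r)"
        using exp_ge_add_one_self[of 1] by (intro mult_right_mono) auto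
      also have "\<dots> = exp (1 - 2 * r)" by (simp add: mult_exp_exp)
      finally show ?thesis by simp
    qed
    show "2 * r - 1 \<le> \<bar>W \<omega>\<bar>"
    proof (cases "X \<omega> = 0")
      case True then show ?thesis by (intro small) simp
    next
      case False
      then have sq: "(cmod (X \<omega>))\<^sup>2 = exp (2 * ln (cmod (X \<omega>)))"
        by (simp add: exp_double)
      consider "ln (cmod (X \<omega>)) < s - r" | "ln (cmod (X \<omega>)) > s + r" using dev by linarith
      then show ?thesis
      proof cases
        case 1 then show ?thesis by (intro small) (simp add: sq)
      next
        case 2
        have "exp (2 * r) \<le> exp (2 * ln (cmod (X \<omega>)) - 2 * s)" using 2 by simp
        also have "\<dots> = (cmod (X \<omega>))\<^sup>2 * exp (- 2 * s)" unfolding sq by (simp add: mult_exp_exp)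
        also have "\<dots> \<le> exp (W \<omega>)" unfolding Y using t(1) by (intro mult_right_mono) auto
        finally show ?thesis by simp
      qed
    qed
  qed
  have "measure P {\<omega> \<in> space P. \<bar>ln (cmod (X \<omega>)) - s\<bar> > r} \<le> measure P {\<omega> \<in> space P. 2 * r - 1 \<le> \<bar>W \<omega>\<bar>}"
    by (intro finite_measure_mono sub) measurable
  also have "\<dots> \<le> (\<integral>\<omega>. \<bar>W \<omega>\<bar> \<partial>P) / (2 * r - 1)"
    using intW r by (intro integral_Markov_inequality_measure[of _ _ "{}"]) auto
  also have "\<dots> \<le> (2 * u + l + 2 * c + 4) / (2 * r - 1)"
    using Eabs r by (intro divide_right_mono) auto
  finally show ?thesis .
qed

text \<open>Independence identifies the joint law of the entries with a product measure, which is where the bounds for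
  determinants live.\<close>

lemma iid_gaussian_matrix_distr:
  assumes G: "iid_gaussian_matrix P n G" and n: "n > 0"
  defines "I \<equiv> {..<n} \<times> {..<n}"
  shows "(\<lambda>\<omega>. \<lambda>ij\<in>I. G \<omega> $$ ij) \<in> P \<rightarrow>\<^sub>M Pi\<^sub>M I (\<lambda>_. complex_gaussian)"
    and "distr P (Pi\<^sub>M I (\<lambda>_. complex_gaussian)) (\<lambda>\<omega>. \<lambda>ij\<in>I. G \<omega> $$ ij) = Pi\<^sub>M I (\<lambda>_. complex_gaussian)"
proof -
  interpret prob_space P using G by (simp add: iid_gaussian_matrix_def)
  have ind: "indep_vars (\<lambda>_. borel) (\<lambda>ij \<omega>. G \<omega> $$ ij) I"
  proof -
    have "(\<lambda>(i, j) \<omega>. G \<omega> $$ (i, j)) = (\<lambda>ij \<omega>. G \<omega> $$ ij)" by (auto simp: fun_eq_iff)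
    then show ?thesis using G unfolding iid_gaussian_matrix_def I_def by metis
  qed
  have gauss: "std_complex_gaussian P (\<lambda>\<omega>. G \<omega> $$ ij)" if "ij \<in> I" for ij
    using G that unfolding iid_gaussian_matrix_def I_def by auto
  have rv: "(\<lambda>\<omega>. G \<omega> $$ ij) \<in> borel_measurable P" if "ij \<in> I" for ij
    using ind that unfolding indep_vars_def by auto
  show meas: "(\<lambda>\<omega>. \<lambda>ij\<in>I. G \<omega> $$ ij) \<in> P \<rightarrow>\<^sub>M Pi\<^sub>M I (\<lambda>_. complex_gaussian)"
    using rv by (intro measurable_restrict) (simp cong: measurable_cong_sets)
  let ?N = "density lborel (\<lambda>x. ennreal (normal_density 0 (sqrt (1/2)) x))"
  have entry: "distr P borel (\<lambda>\<omega>. G \<omega> $$ ij) = complex_gaussian" if ij: "ij \<in> I" for ij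
  proof -
    let ?X = "\<lambda>\<omega>. G \<omega> $$ ij"
    note g = gauss[OF ij, unfolded std_complex_gaussian_def]
    have dR: "distr P borel (\<lambda>\<omega>. Re (?X \<omega>)) = ?N" and dI: "distr P borel (\<lambda>\<omega>. Im (?X \<omega>)) = ?N"
      using g distributed_distr_eq_density[of P lborel "\<lambda>\<omega>. Re (?X \<omega>)"] distributed_distr_eq_density[of P lborel "\<lambda>\<omega>. Im (?X \<omega>)"]
        distr_cong[of P P lborel borel "\<lambda>\<omega>. Re (?X \<omega>)"] distr_cong[of P P lborel borel "\<lambda>\<omega>. Im (?X \<omega>)"] by auto
    have joint: "distr P (borel \<Otimes>\<^sub>M borel) (\<lambda>\<omega>. (Re (?X \<omega>), Im (?X \<omega>))) = ?N \<Otimes>\<^sub>M ?N"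
      using g unfolding indep_var_distribution_eq dR dI by simp
    note [measurable] = rv[OF ij]
    have "complex_gaussian = distr (distr P (borel \<Otimes>\<^sub>M borel) (\<lambda>\<omega>. (Re (?X \<omega>), Im (?X \<omega>)))) borel (\<lambda>(x, y). Complex x y)"
      unfolding complex_gaussian_def joint ..
    also have "\<dots> = distr P borel ((\<lambda>(x, y). Complex x y) \<circ> (\<lambda>\<omega>. (Re (?X \<omega>), Im (?X \<omega>))))"
      by (rule distr_distr) measurable
    also have "(\<lambda>(x, y). Complex x y) \<circ> (\<lambda>\<omega>. (Re (?X \<omega>), Im (?X \<omega>))) = ?X" by (auto simp: fun_eq_iff)
    finally show ?thesis ..
  qed
  have "I \<noteq> {}" using n by (auto simp: I_def)
  have "distr P (Pi\<^sub>M I (\<lambda>_. complex_gaussian)) (\<lambda>\<omega>. \<lambda>ij\<in>I. G \<omega> $$ ij) = distr P (Pi\<^sub>M I (\<lambda>_. borel)) (\<lambda>\<omega>. \<lambda>ij\<in>I. G \<omega> $$ ij)"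
    by (intro distr_cong sets_PiM_cong) auto
  also have "\<dots> = Pi\<^sub>M I (\<lambda>ij. distr P borel (\<lambda>\<omega>. G \<omega> $$ ij))"
    using ind rv \<open>I \<noteq> {}\<close> by (subst (asm) indep_vars_iff_distr_eq_PiM') auto
  also have "\<dots> = Pi\<^sub>M I (\<lambda>_. complex_gaussian)" by (intro PiM_cong refl entry)
  finally show "distr P (Pi\<^sub>M I (\<lambda>_. complex_gaussian)) (\<lambda>\<omega>. \<lambda>ij\<in>I. G \<omega> $$ ij) = Pi\<^sub>M I (\<lambda>_. complex_gaussian)" .
qed

text \<open>Above the threshold, replacing \<open>\<sigma>\<^sub>i\<^sup>2\<close> by \<open>\<sigma>\<^sub>i\<^sup>2 + \<delta>\<^sup>2 (n - i)\<close> costs at most the factor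
  \<open>1 + q\<^sup>-\<^sup>2\<close>. Indices start at \<open>0\<close> here.\<close>

lemma ln_prod_second_moment_le:
  fixes \<sigma> :: "nat \<Rightarrow> real"
  assumes k: "k \<le> n" and \<delta>: "\<delta> > 0" and q: "q > 0"
    and \<sigma>: "\<And>i. k \<le> i \<Longrightarrow> i < n \<Longrightarrow> q * \<delta> * sqrt (real n - real i) \<le> \<sigma> i"
  shows "ln (\<Prod>i<n. (\<sigma> i)\<^sup>2 + \<delta>\<^sup>2 * (real n - real i))
    \<le> (\<Sum>i<k. ln ((\<sigma> i)\<^sup>2 + \<delta>\<^sup>2 * (real n - real i))) + ln (\<Prod>i=k..<n. (\<sigma> i)\<^sup>2) + n / q\<^sup>2"
proof -
  have pos: "(\<sigma> i)\<^sup>2 + \<delta>\<^sup>2 * (real n - real i) > 0" if "i < n" for i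
    using that \<delta> by (intro add_nonneg_pos) auto
  have \<sigma>pos: "\<sigma> i > 0" if "k \<le> i" "i < n" for i
  proof -
    have "0 < q * \<delta> * sqrt (real n - real i)" using q \<delta> that by simp
    then show ?thesis using \<sigma>[OF that] by linarith
  qed
  have each: "ln ((\<sigma> i)\<^sup>2 + \<delta>\<^sup>2 * (real n - real i)) \<le> ln ((\<sigma> i)\<^sup>2) + 1 / q\<^sup>2" if i: "k \<le> i" "i < n" for i
  proof -
    have "(q * \<delta> * sqrt (real n - real i))\<^sup>2 \<le> (\<sigma> i)\<^sup>2"
      using q \<delta> i \<sigma>[OF i] by (intro power_mono) auto
    then have "q\<^sup>2 * (\<delta>\<^sup>2 * (real n - real i)) \<le> (\<sigma> i)\<^sup>2" using i by (simp add: power_mult_distrib mult.assoc)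
    then have "\<delta>\<^sup>2 * (real n - real i) \<le> (\<sigma> i)\<^sup>2 * (1 / q\<^sup>2)" using q by (simp add: field_simps)
    then have le: "(\<sigma> i)\<^sup>2 + \<delta>\<^sup>2 * (real n - real i) \<le> (\<sigma> i)\<^sup>2 * (1 + 1 / q\<^sup>2)" by (simp add: distrib_left)
    have q1: "1 + 1 / q\<^sup>2 > 0" using q by (intro add_pos_pos) auto
    have "ln ((\<sigma> i)\<^sup>2 + \<delta>\<^sup>2 * (real n - real i)) \<le> ln ((\<sigma> i)\<^sup>2 * (1 + 1 / q\<^sup>2))"
      using le pos[OF i(2)] by (intro ln_mono) auto
    also have "\<dots> = ln ((\<sigma> i)\<^sup>2) + ln (1 + 1 / q\<^sup>2)" using \<sigma>pos[OF i] q1 by (intro ln_mult_pos) auto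
    also have "ln (1 + 1 / q\<^sup>2) \<le> 1 / q\<^sup>2" using q by (intro ln_add_one_self_le_self) auto
    finally show ?thesis by simp
  qed
  have split: "{..<n} = {..<k} \<union> {k..<n}" using k by auto
  have "ln (\<Prod>i<n. (\<sigma> i)\<^sup>2 + \<delta>\<^sup>2 * (real n - real i)) = (\<Sum>i<n. ln ((\<sigma> i)\<^sup>2 + \<delta>\<^sup>2 * (real n - real i)))"
    using pos by (intro ln_prod) (auto simp: less_imp_neq[symmetric])
  also have "\<dots> = (\<Sum>i<k. ln ((\<sigma> i)\<^sup>2 + \<delta>\<^sup>2 * (real n - real i))) + (\<Sum>i=k..<n. ln ((\<sigma> i)\<^sup>2 + \<delta>\<^sup>2 * (real n - real i)))"
    unfolding split by (rule sum.union_disjoint) auto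
  also have "(\<Sum>i=k..<n. ln ((\<sigma> i)\<^sup>2 + \<delta>\<^sup>2 * (real n - real i))) \<le> (\<Sum>i=k..<n. ln ((\<sigma> i)\<^sup>2) + 1 / q\<^sup>2)"
    using each by (intro sum_mono) auto
  also have "\<dots> = ln (\<Prod>i=k..<n. (\<sigma> i)\<^sup>2) + real (n - k) / q\<^sup>2"
    using \<sigma>pos by (subst ln_prod) (force simp: sum.distrib)+
  also have "\<dots> \<le> ln (\<Prod>i=k..<n. (\<sigma> i)\<^sup>2) + n / q\<^sup>2"
    using q by (intro add_left_mono divide_right_mono) auto
  finally show ?thesis by simp
qed

text \<open>The elementary Stirling bound \<open>k\<^sup>k / k! \<le> exp k\<close>, with \<open>k log k\<close> replaced by
  \<open>k log n\<close>; the difference \<open>k log (n / k)\<close> is estimated by \<open>log y \<le> 2 sqrt y\<close>.\<close>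

lemma ln_fact_ge: "real k * ln (real n) - 2 * real n * sqrt (real k / real n) - real k \<le> ln (fact k)"
  if n: "n > 0"
proof (cases "k = 0")
  case False
  have "real k ^ k / fact k \<le> exp (real k)"
  proof -
    have "(\<Sum>j\<in>{k}. inverse (fact j) *\<^sub>R real k ^ j) \<le> (\<Sum>j. inverse (fact j) *\<^sub>R real k ^ j)"
      by (rule sum_le_suminf[OF summable_exp_generic]) auto
    then show ?thesis by (simp add: exp_def divide_inverse mult.commute)
  qed
  then have "ln (real k ^ k / fact k) \<le> real k"
    using False ln_mono[of "real k ^ k / fact k" "exp (real k)"] by simp
  then have 1: "real k * ln (real k) - real k \<le> ln (fact k)"
    using False by (simp add: ln_div ln_realpow)
  have kn: "real k / real n > 0" using False n by simp
  have "sqrt (real n / real k) > 0" using False n by simp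
  then have "ln (sqrt (real n / real k)) \<le> sqrt (real n / real k)"
    using ln_le_minus_one[of "sqrt (real n / real k)"] by linarith
  then have "ln (real n / real k) \<le> 2 * sqrt (real n / real k)" using False n by (simp add: ln_sqrt)
  then have "real k * (ln (real n) - ln (real k)) \<le> real k * (2 * sqrt (real n / real k))"
    using False n by (intro mult_left_mono) (auto simp: ln_div)
  also have "\<dots> = 2 * real n * sqrt (real k / real n)"
  proof -
    have "real k * sqrt (real n / real k) = real n * sqrt (real k / real n)"
    proof -
      have "real k = sqrt (real k) * sqrt (real k)" "real n = sqrt (real n) * sqrt (real n)" by simp_all
      then show ?thesis using False n by (simp add: real_sqrt_divide field_simps)
    qed
    then show ?thesis by simp
  qed
  finally show ?thesis using 1 by (simp add: right_diff_distrib)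
qed (simp)

text \<open>Here \<open>u\<close> and \<open>l\<close> bound the defects of the upper and of the lower estimate for the
  determinant against \<open>log \<bar>det B\<bar> + h\<close>. The last bracket in the hypothesis on \<open>u\<close> is
  nonnegative and pays for the degenerate case in which no index satisfies the inequality defining
  \<open>N\<^sup>*\<close>: then a single singular value, not known to be small, is missing from \<open>B\<close>.\<close>

lemma det_deviation:
  assumes A: "A \<in> carrier_mat n n" and n: "n \<ge> 1"
    and G: "iid_gaussian_matrix P n G" and \<gamma>: "\<gamma> > 1/2" and \<epsilon>: "\<epsilon> > 0" and r: "r > 1/2"
  defines "k \<equiv> N_star \<gamma> \<epsilon> A"
  assumes u: "u \<ge> 0" "real k * ((1 - 2 * \<gamma>) * ln n) + real k * ln (1 + (inverse \<epsilon>)\<^sup>2) + n * \<epsilon>\<^sup>2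
      + ((2 * \<gamma> - 1) * ln n + ln 2 + 2 * ln (max 1 (sing_val A 1))) - 2 * h \<le> u"
    and l: "l \<ge> 0" "2 * h + 2 * \<gamma> * (real k * ln n) - (real k * ln n - 2 * real n * sqrt (real k / n) - k) \<le> l"
  shows "measure P {\<omega> \<in> space P. \<bar>ln (cmod (Determinant.det (Sigma_mat A + complex_of_real (real n powr (- \<gamma>)) \<cdot>\<^sub>m G \<omega>)))
      - (ln (cmod (Determinant.det (B_mat \<gamma> \<epsilon> A))) + h)\<bar> > r}
    \<le> (2 * u + l + 2 * (k * shift_loss) + 4) / (2 * r - 1)"
proof -
  interpret prob_space P using G by (simp add: iid_gaussian_matrix_def)
  define \<delta> where "\<delta> = real n powr (- \<gamma>)"
  define q where "q = inverse \<epsilon>"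
  define \<sigma> where "\<sigma> i = sing_val A (i + 1)" for i
  define \<mu> where "\<mu> = (\<lambda>(i, j). if i = j then complex_of_real (\<sigma> i) else 0 :: complex)"
  define I where "I = {..<n} \<times> {..<n}"
  define T where "T \<omega> = (\<lambda>ij\<in>I. G \<omega> $$ ij)" for \<omega>
  define D where "D x = noisy_minor \<mu> \<delta> x 0 n id" for x
  define b where "b = (\<Prod>i=k..<n. (\<sigma> i)\<^sup>2)"
  have \<delta>: "\<delta> > 0" using n by (simp add: \<delta>_def)
  have q: "q > 0" using \<epsilon> by (simp add: q_def)
  note ks = N_star_properties[OF A n, of \<gamma> \<epsilon>, folded k_def]
  have \<sigma>_large: "q * \<delta> * sqrt (real n - real i) \<le> \<sigma> i" if "k \<le> i" "i < n" for i
    using ks(3)[of "i + 1"] that by (simp add: q_def \<delta>_def \<sigma>_def)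
  have \<sigma>pos: "\<sigma> i > 0" if "k \<le> i" "i < n" for i
  proof -
    have "0 < q * \<delta> * sqrt (real n - real i)" using q \<delta> that by simp
    then show ?thesis using \<sigma>_large[OF that] by linarith
  qed
  have b: "b > 0" unfolding b_def by (intro prod_pos zero_less_power \<sigma>pos) auto
  have lnB: "2 * ln (cmod (Determinant.det (B_mat \<gamma> \<epsilon> A))) = ln b"
  proof -
    have "(cmod (Determinant.det (B_mat \<gamma> \<epsilon> A)))\<^sup>2 = b"
      unfolding det_B_mat[OF A] b_def k_def \<sigma>_def by (simp add: prod_norm[symmetric] prod_power_distrib)
    then have "ln b = ln ((cmod (Determinant.det (B_mat \<gamma> \<epsilon> A)))\<^sup>2)" by simp
    also have "\<dots> = 2 * ln (cmod (Determinant.det (B_mat \<gamma> \<epsilon> A)))" by (simp add: ln_realpow)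
    finally show ?thesis by simp
  qed
  note distr = iid_gaussian_matrix_distr[OF G, folded I_def]
  have T: "T \<in> P \<rightarrow>\<^sub>M Pi\<^sub>M I (\<lambda>_. complex_gaussian)" "distr P (Pi\<^sub>M I (\<lambda>_. complex_gaussian)) T = Pi\<^sub>M I (\<lambda>_. complex_gaussian)"
    using distr n unfolding T_def by auto
  have Dm: "D \<in> borel_measurable (Pi\<^sub>M I (\<lambda>_. complex_gaussian))"
    unfolding D_def by (rule noisy_minor_measurable) (simp add: I_def)
  have transfer: "(\<integral>\<^sup>+ \<omega>. f (D (T \<omega>)) \<partial>P) = (\<integral>\<^sup>+ x. f (D x) \<partial>Pi\<^sub>M I (\<lambda>_. complex_gaussian))"
    if "f \<in> borel_measurable borel" for f :: "complex \<Rightarrow> ennreal"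
    using measurable_compose[OF Dm that] T(1)
    by (subst T(2)[symmetric], subst nn_integral_distr) (auto simp: T(2))
  have det: "Determinant.det (Sigma_mat A + complex_of_real \<delta> \<cdot>\<^sub>m G \<omega>) = D (T \<omega>)" if "\<omega> \<in> space P" for \<omega>
    using det_Sigma_mat_noise[OF A, of "G \<omega>" \<delta>] G that
    unfolding D_def T_def \<mu>_def \<sigma>_def I_def iid_gaussian_matrix_def by simp
  let ?U = "\<Prod>i<n. (\<sigma> i)\<^sup>2 + \<delta>\<^sup>2 * (real n - real i)"
  let ?L = "(\<delta>\<^sup>2) ^ k * fact k * b"
  let ?s = "ln (cmod (Determinant.det (B_mat \<gamma> \<epsilon> A))) + h"
  have "measure P {\<omega> \<in> space P. \<bar>ln (cmod (D (T \<omega>))) - ?s\<bar> > r}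
    \<le> (2 * u + l + 2 * (k * shift_loss) + 4) / (2 * r - 1)"
  proof (rule ln_deviation_bound[where U = ?U and L = ?L])
    show "(\<lambda>\<omega>. D (T \<omega>)) \<in> borel_measurable P" by (rule measurable_compose[OF T(1) Dm])
    have "(\<integral>\<^sup>+ x. ennreal ((cmod (noisy_minor \<mu> \<delta> x 0 n id))\<^sup>2) \<partial>Pi\<^sub>M ({0..<0 + n} \<times> {..<n}) (\<lambda>_. complex_gaussian))
        \<le> ennreal (\<Prod>i<n. (\<sigma> (0 + i))\<^sup>2 + \<delta>\<^sup>2 * (n - i))"
      unfolding \<mu>_def by (rule noisy_minor_second_moment) auto
    then show "(\<integral>\<^sup>+ \<omega>. ennreal ((cmod (D (T \<omega>)))\<^sup>2) \<partial>P) \<le> ennreal ?U"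
      unfolding transfer[of "\<lambda>w. ennreal ((cmod w)\<^sup>2)", simplified] by (simp add: D_def I_def atLeast0LessThan)
    show "?U > 0" using \<delta> by (intro prod_pos ballI add_nonneg_pos) auto
    show "ennreal (ln (1 + t * ?L) / 2) \<le> (\<integral>\<^sup>+ \<omega>. ennreal (smooth_log t (D (T \<omega>))) \<partial>P) + ennreal (k * shift_loss)"
      if "t > 0" for t
    proof -
      have "(\<lambda>w. ennreal (smooth_log t w)) \<in> borel_measurable borel" by measurable
      note tr = transfer[OF this]
      show ?thesis unfolding tr unfolding b_def D_def I_def \<mu>_def
        by (rule noisy_diag_log_lower_bound) (use \<delta> that ks(2) \<sigma>pos in auto)
    qed
    show "?L > 0" using \<delta> b by simp
    show "real k * shift_loss \<ge> 0" using shift_loss_nonneg by simp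
    have ln\<delta>: "ln (\<delta>\<^sup>2) = - 2 * \<gamma> * ln n" using n \<delta> by (simp add: ln_realpow \<delta>_def ln_powr)
    show "2 * ?s - ln ?L \<le> l"
    proof -
      have "ln ?L = k * ln (\<delta>\<^sup>2) + ln (fact k) + ln b"
        using \<delta> b by (simp add: ln_mult_pos ln_realpow)
      also have "k * ln (\<delta>\<^sup>2) = - (2 * \<gamma> * (real k * ln n))" by (simp add: ln\<delta>)
      finally have "ln ?L = - (2 * \<gamma> * (real k * ln n)) + ln (fact k) + ln b" .
      moreover have "real k * ln n - 2 * real n * sqrt (real k / n) - k \<le> ln (fact k)"
        using n by (intro ln_fact_ge) auto
      moreover have "2 * (c + h) - x \<le> l" if "x = - a + f + y" "z \<le> f" "2 * h + a - z \<le> l" "2 * c = y"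
        for x a f y z c :: real using that by argo
      ultimately show ?thesis using l(2) lnB by blast
    qed
    show "ln ?U - 2 * ?s \<le> u"
    proof -
      have 1: "ln ?U \<le> (\<Sum>i<k. ln ((\<sigma> i)\<^sup>2 + \<delta>\<^sup>2 * (real n - real i))) + ln b + n / q\<^sup>2"
        unfolding b_def by (rule ln_prod_second_moment_le[OF ks(2) \<delta> q \<sigma>_large])
      have nq: "n / q\<^sup>2 = n * \<epsilon>\<^sup>2" by (simp add: q_def power_inverse divide_inverse)
      \<comment> \<open>the mean square of the noise in a row; at most \<open>1\<close> since \<open>\<gamma> > 1/2\<close>\<close>
      let ?v = "\<delta>\<^sup>2 * real n"
      have v: "?v > 0" "ln ?v = (1 - 2 * \<gamma>) * ln n"
        using \<delta> n by (simp_all add: ln_mult_pos ln\<delta> algebra_simps)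
      have lnn: "ln (real n) \<ge> 0" using n by simp
      have v1: "?v \<le> 1"
      proof -
        have "ln ?v \<le> 0" unfolding v(2) using lnn \<gamma> by (intro mult_nonpos_nonneg) auto
        then show ?thesis using v(1) by simp
      qed
      let ?w = "max 1 (sing_val A 1)"
      have extra: "(2 * \<gamma> - 1) * ln n + ln 2 + 2 * ln ?w \<ge> 0"
        using lnn \<gamma> by (intro add_nonneg_nonneg mult_nonneg_nonneg) auto
      have \<sigma>0: "\<sigma> i \<ge> 0" if "i < n" for i unfolding \<sigma>_def using that by (intro sing_val_nonneg[OF A]) auto
      have "(\<Sum>i<k. ln ((\<sigma> i)\<^sup>2 + \<delta>\<^sup>2 * (real n - real i)))
          \<le> real k * ((1 - 2 * \<gamma>) * ln n) + real k * ln (1 + q\<^sup>2) + ((2 * \<gamma> - 1) * ln n + ln 2 + 2 * ln ?w)"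
      proof (cases "\<forall>i. 1 \<le> i \<longrightarrow> i \<le> k \<longrightarrow> sing_val A i \<le> q * \<delta> * sqrt (real n - real k + 1)")
        case True
        have "ln ((\<sigma> i)\<^sup>2 + \<delta>\<^sup>2 * (real n - real i)) \<le> (1 - 2 * \<gamma>) * ln n + ln (1 + q\<^sup>2)" if "i < k" for i
        proof -
          have "\<sigma> i \<le> q * \<delta> * sqrt (real n - real k + 1)" using True that by (simp add: \<sigma>_def)
          also have "\<dots> \<le> q * \<delta> * sqrt (real n)" using q \<delta> ks(1) by (intro mult_left_mono real_sqrt_le_mono) auto
          finally have "(\<sigma> i)\<^sup>2 \<le> (q * \<delta> * sqrt (real n))\<^sup>2" using \<sigma>0[of i] that ks(2) by (intro power_mono) auto
          then have "(\<sigma> i)\<^sup>2 \<le> q\<^sup>2 * ?v" by (simp add: power_mult_distrib mult.assoc)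
          moreover have "\<delta>\<^sup>2 * (real n - real i) \<le> ?v" by (intro mult_left_mono) auto
          ultimately have "(\<sigma> i)\<^sup>2 + \<delta>\<^sup>2 * (real n - real i) \<le> q\<^sup>2 * ?v + ?v" by (rule add_mono)
          then have le: "(\<sigma> i)\<^sup>2 + \<delta>\<^sup>2 * (real n - real i) \<le> ?v * (1 + q\<^sup>2)"
            by (simp only: distrib_left mult_1_right mult.commute[of "q\<^sup>2"] add.commute)
          have "(\<sigma> i)\<^sup>2 + \<delta>\<^sup>2 * (real n - real i) > 0" using \<delta> that ks(2) by (intro add_nonneg_pos) auto
          then have "ln ((\<sigma> i)\<^sup>2 + \<delta>\<^sup>2 * (real n - real i)) \<le> ln (?v * (1 + q\<^sup>2))" using le by (intro ln_mono) auto
          also have "\<dots> = ln ?v + ln (1 + q\<^sup>2)" using v(1) by (intro ln_mult_pos) (auto intro: add_pos_nonneg)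
          finally show ?thesis using v(2) by simp
        qed
        then have "(\<Sum>i<k. ln ((\<sigma> i)\<^sup>2 + \<delta>\<^sup>2 * (real n - real i))) \<le> (\<Sum>i<k. (1 - 2 * \<gamma>) * ln n + ln (1 + q\<^sup>2))"
          by (intro sum_mono) auto
        also have "\<dots> = real k * ((1 - 2 * \<gamma>) * ln n) + real k * ln (1 + q\<^sup>2)"
          by (simp only: sum_constant card_lessThan distrib_left)
        finally show ?thesis using extra by linarith
      next
        case False
        then have k1: "k = 1" using ks(4) by (auto simp: q_def \<delta>_def)
        have w: "?w \<ge> 1" by simp
        have "(\<sigma> 0)\<^sup>2 \<le> ?w\<^sup>2" using \<sigma>0[of 0] n by (intro power_mono) (auto simp: \<sigma>_def)
        moreover have "?v \<le> ?w\<^sup>2" using v1 w by (meson one_le_power order_trans)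
        ultimately have le: "(\<sigma> 0)\<^sup>2 + ?v \<le> 2 * ?w\<^sup>2" by linarith
        have "(\<sigma> 0)\<^sup>2 + ?v > 0" using v(1) by (intro add_nonneg_pos) auto
        then have "ln ((\<sigma> 0)\<^sup>2 + ?v) \<le> ln (2 * ?w\<^sup>2)" using le by (intro ln_mono) auto
        also have "\<dots> = ln 2 + 2 * ln ?w" using w by (subst ln_mult_pos) (auto simp: ln_realpow)
        finally have "ln ((\<sigma> 0)\<^sup>2 + ?v) \<le> ln 2 + 2 * ln ?w" .
        moreover have "ln (1 + q\<^sup>2) \<ge> 0" by simp
        moreover have "real 1 * ((1 - 2 * \<gamma>) * ln n) + real 1 * ln (1 + q\<^sup>2) + ((2 * \<gamma> - 1) * ln n + ln 2 + 2 * ln ?w)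
            = ln (1 + q\<^sup>2) + (ln 2 + 2 * ln ?w)" by (simp add: algebra_simps)
        moreover have "(\<Sum>i<1. ln ((\<sigma> i)\<^sup>2 + \<delta>\<^sup>2 * (real n - real i))) = ln ((\<sigma> 0)\<^sup>2 + ?v)" by simp
        ultimately show ?thesis unfolding k1 by linarith
      qed
      then show ?thesis using 1[unfolded nq] u(2)[folded q_def] lnB by argo
    qed
  qed (use u l r prob_space_axioms in auto)
  moreover have "{\<omega> \<in> space P. \<bar>ln (cmod (D (T \<omega>))) - ?s\<bar> > r}
    = {\<omega> \<in> space P. \<bar>ln (cmod (Determinant.det (Sigma_mat A + complex_of_real (real n powr (- \<gamma>)) \<cdot>\<^sub>m G \<omega>))) - ?s\<bar> > r}"
    unfolding \<delta>_def[symmetric] by (auto simp: det)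
  ultimately show ?thesis by simp
qed

section \<open>Passage to the limit\<close>

theorem theorem2p1:
  fixes M :: "nat \<Rightarrow> complex mat"
    and P :: "nat \<Rightarrow> 'a measure"
    and G :: "nat \<Rightarrow> 'a \<Rightarrow> complex mat"
    and \<gamma> \<alpha> :: real
    and z :: complex
    and \<epsilon> :: "nat \<Rightarrow> real"
  assumes "\<gamma> > 1/2"
    and "\<And>N. N \<ge> 1 \<Longrightarrow> M N \<in> carrier_mat N N"
    and "\<And>N. N \<ge> 1 \<Longrightarrow> iid_gaussian_matrix (P N) N (G N)"
    and "smallest_sv_subexponential M z"
    and "(\<lambda>N. real (N_star \<gamma> (\<epsilon> N) (shifted (M N) z)) * ln (real N) / real N) \<longlonglongrightarrow> \<alpha>"
    and "((\<forall>N\<ge>1. \<epsilon> N > 0) \<and> \<epsilon> \<longlonglongrightarrow> 0 \<and> (\<lambda>N. ln (inverse (\<epsilon> N)) / ln (real N)) \<longlonglongrightarrow> 0)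
         \<or> (\<alpha> = 0 \<and> (\<exists>\<eta>>0. \<forall>N\<ge>1. \<epsilon> N = real N powr (- \<eta>)))"
  shows "tendsto_in_prob_const P
    (\<lambda>N \<omega>. 1 / real N * ln (cmod (Determinant.det
               (Sigma_mat (shifted (M N) z) + complex_of_real (real N powr (- \<gamma>)) \<cdot>\<^sub>m G N \<omega>)))
           - 1 / real N * ln (cmod (Determinant.det (B_mat \<gamma> (\<epsilon> N) (shifted (M N) z)))))
    (- \<alpha> * (\<gamma> - 1/2))"
  unfolding tendsto_in_prob_const_def
proof (intro allI impI)
  fix d :: real assume d: "d > 0"
  define A where "A N = shifted (M N) z" for N
  define k where "k N = N_star \<gamma> (\<epsilon> N) (A N)" for N
  define \<tau> where "\<tau> = - \<alpha> * (\<gamma> - 1/2)"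
  have A: "A N \<in> carrier_mat N N" if "N \<ge> 1" for N
    using assms(2)[OF that] by (auto simp: A_def shifted_def)
  have kl: "(\<lambda>N. real (k N) * ln (real N) / real N) \<longlonglongrightarrow> \<alpha>" using assms(5) by (simp add: k_def A_def)
  have ln0: "(\<lambda>N. inverse (ln (real N))) \<longlonglongrightarrow> 0"
    by (intro tendsto_inverse_0_at_top filterlim_compose[OF ln_at_top filterlim_real_sequentially])
  have kN: "(\<lambda>N. real (k N) / real N) \<longlonglongrightarrow> 0"
  proof -
    have "(\<lambda>N. real (k N) * ln (real N) / real N * inverse (ln (real N))) \<longlonglongrightarrow> \<alpha> * 0"
      by (intro tendsto_mult kl ln0)
    moreover have "eventually (\<lambda>N. real (k N) * ln (real N) / real N * inverse (ln (real N)) = real (k N) / real N) sequentially"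
      using eventually_ge_at_top[of 2] by eventually_elim simp
    ultimately show ?thesis unfolding mult_zero_right by (rule Lim_transform_eventually)
  qed
  \<comment> \<open>both ways of choosing \<open>\<epsilon>\<close> lead to the same three facts\<close>
  have "eventually (\<lambda>N. \<epsilon> N > 0) sequentially \<and> \<epsilon> \<longlonglongrightarrow> 0 \<and> (\<lambda>N. real (k N) * ln (inverse (\<epsilon> N)) / real N) \<longlonglongrightarrow> 0"
    using assms(6)
  proof
    assume e: "(\<forall>N\<ge>1. \<epsilon> N > 0) \<and> \<epsilon> \<longlonglongrightarrow> 0 \<and> (\<lambda>N. ln (inverse (\<epsilon> N)) / ln (real N)) \<longlonglongrightarrow> 0"
    have "(\<lambda>N. (real (k N) * ln (real N) / real N) * (ln (inverse (\<epsilon> N)) / ln (real N))) \<longlonglongrightarrow> \<alpha> * 0"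
      using e by (intro tendsto_mult kl) blast
    moreover have "eventually (\<lambda>N. (real (k N) * ln (real N) / real N) * (ln (inverse (\<epsilon> N)) / ln (real N))
        = real (k N) * ln (inverse (\<epsilon> N)) / real N) sequentially"
      using eventually_ge_at_top[of 2] by eventually_elim simp
    ultimately have "(\<lambda>N. real (k N) * ln (inverse (\<epsilon> N)) / real N) \<longlonglongrightarrow> 0"
      unfolding mult_zero_right by (rule Lim_transform_eventually)
    moreover have "eventually (\<lambda>N. \<epsilon> N > 0) sequentially"
      using eventually_ge_at_top[of 1] by eventually_elim (use e in blast)
    ultimately show ?thesis using e by blast
  next
    assume "\<alpha> = 0 \<and> (\<exists>\<eta>>0. \<forall>N\<ge>1. \<epsilon> N = real N powr (- \<eta>))"
    then obtain \<eta> where \<eta>: "\<alpha> = 0" "\<eta> > 0" "\<And>N. N \<ge> 1 \<Longrightarrow> \<epsilon> N = real N powr (- \<eta>)" by blast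
    have ev: "eventually (\<lambda>N. real N powr (- \<eta>) = \<epsilon> N) sequentially"
      using eventually_ge_at_top[of 1] by eventually_elim (rule \<eta>(3)[symmetric])
    have "(\<lambda>N. real N powr (- \<eta>)) \<longlonglongrightarrow> 0"
      using \<eta>(2) by (intro tendsto_neg_powr filterlim_real_sequentially) simp
    then have "\<epsilon> \<longlonglongrightarrow> 0" using ev by (rule Lim_transform_eventually)
    moreover have "eventually (\<lambda>N. \<epsilon> N > 0) sequentially"
      using eventually_ge_at_top[of 1] by eventually_elim (simp add: \<eta>(3))
    moreover have "(\<lambda>N. real (k N) * ln (inverse (\<epsilon> N)) / real N) \<longlonglongrightarrow> 0"
    proof -
      have "(\<lambda>N. \<eta> * (real (k N) * ln (real N) / real N)) \<longlonglongrightarrow> \<eta> * \<alpha>"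
        by (intro tendsto_mult tendsto_const kl)
      moreover have "eventually (\<lambda>N. \<eta> * (real (k N) * ln (real N) / real N) = real (k N) * ln (inverse (\<epsilon> N)) / real N) sequentially"
        using eventually_ge_at_top[of 1] by eventually_elim (simp add: \<eta>(3) ln_inverse ln_powr)
      ultimately show ?thesis unfolding \<eta>(1) mult_zero_right by (rule Lim_transform_eventually)
    qed
    ultimately show ?thesis by blast
  qed
  then have \<epsilon>pos: "eventually (\<lambda>N. \<epsilon> N > 0) sequentially" and \<epsilon>0: "\<epsilon> \<longlonglongrightarrow> 0"
    and kq: "(\<lambda>N. real (k N) * ln (inverse (\<epsilon> N)) / real N) \<longlonglongrightarrow> 0" by blast+
  have kq2: "(\<lambda>N. real (k N) * ln (1 + (inverse (\<epsilon> N))\<^sup>2) / real N) \<longlonglongrightarrow> 0"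
  proof (rule tendsto_sandwich)
    show "eventually (\<lambda>N. 0 \<le> real (k N) * ln (1 + (inverse (\<epsilon> N))\<^sup>2) / real N) sequentially" by simp
    have "eventually (\<lambda>N. \<epsilon> N < 1) sequentially" using order_tendstoD(2)[OF \<epsilon>0, of 1] by simp
    with \<epsilon>pos show "eventually (\<lambda>N. real (k N) * ln (1 + (inverse (\<epsilon> N))\<^sup>2) / real N
        \<le> ln 2 * (real (k N) / real N) + 2 * (real (k N) * ln (inverse (\<epsilon> N)) / real N)) sequentially"
    proof eventually_elim
      case (elim N)
      let ?q = "inverse (\<epsilon> N)"
      have q: "?q \<ge> 1" using elim by (simp add: one_le_inverse)
      then have "1 + ?q\<^sup>2 \<le> 2 * ?q\<^sup>2" using one_le_power[OF q, of 2] by linarith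
      then have "ln (1 + ?q\<^sup>2) \<le> ln (2 * ?q\<^sup>2)" using q by (intro ln_mono) (auto intro: add_pos_nonneg)
      also have "\<dots> = ln 2 + 2 * ln ?q" using q elim by (subst ln_mult_pos) (auto simp: ln_realpow)
      finally have "ln (1 + ?q\<^sup>2) \<le> ln 2 + 2 * ln ?q" .
      then have "real (k N) * ln (1 + ?q\<^sup>2) / real N \<le> real (k N) * (ln 2 + 2 * ln ?q) / real N"
        by (intro divide_right_mono mult_left_mono) auto
      then show ?case by (simp add: distrib_left add_divide_distrib mult_ac)
    qed
    have "(\<lambda>N. ln 2 * (real (k N) / real N) + 2 * (real (k N) * ln (inverse (\<epsilon> N)) / real N)) \<longlonglongrightarrow> ln 2 * 0 + 2 * 0"
      by (intro tendsto_add tendsto_mult tendsto_const kN kq)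
    then show "(\<lambda>N. ln 2 * (real (k N) / real N) + 2 * (real (k N) * ln (inverse (\<epsilon> N)) / real N)) \<longlonglongrightarrow> 0" by simp
  qed simp
  \<comment> \<open>absolute values make the defects nonnegative; both are \<open>o(N)\<close> because the main terms cancel\<close>
  define u where "u N = \<bar>real (k N) * ((1 - 2 * \<gamma>) * ln N) + real (k N) * ln (1 + (inverse (\<epsilon> N))\<^sup>2) + N * (\<epsilon> N)\<^sup>2
      + ((2 * \<gamma> - 1) * ln N + ln 2 + 2 * ln (max 1 (sing_val (A N) 1))) - 2 * (N * \<tau>)\<bar>" for N :: nat
  define l where "l N = \<bar>2 * (N * \<tau>) + 2 * \<gamma> * (real (k N) * ln N)
      - (real (k N) * ln N - 2 * real N * sqrt (real (k N) / N) - k N)\<bar>" for N :: nat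
  have lnN: "(\<lambda>N. ln (real N) / real N) \<longlonglongrightarrow> 0" using lim_ln_over_n by simp
  have u0: "(\<lambda>N. u N / N) \<longlonglongrightarrow> 0"
  proof -
    have lim: "(\<lambda>N. \<bar>(1 - 2 * \<gamma>) * (real (k N) * ln N / N) + real (k N) * ln (1 + (inverse (\<epsilon> N))\<^sup>2) / N + (\<epsilon> N)\<^sup>2
        + ((2 * \<gamma> - 1) * (ln N / N) + ln 2 * (1 / N) + 2 * (ln (max 1 (sing_val (A N) 1)) / N)) - 2 * \<tau>\<bar>)
      \<longlonglongrightarrow> \<bar>(1 - 2 * \<gamma>) * \<alpha> + 0 + 0\<^sup>2 + ((2 * \<gamma> - 1) * 0 + ln 2 * 0 + 2 * 0) - 2 * \<tau>\<bar>"
      using assms(4) lim_1_over_n[where 'a = real] unfolding smallest_sv_subexponential_def A_def[symmetric]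
      by (intro tendsto_rabs tendsto_diff tendsto_add tendsto_mult tendsto_const tendsto_power kl kq2 \<epsilon>0 lnN) simp_all
    have zero: "(1 - 2 * \<gamma>) * \<alpha> + 0 + 0\<^sup>2 + ((2 * \<gamma> - 1) * 0 + ln 2 * 0 + 2 * 0) - 2 * \<tau> = 0"
      by (simp add: \<tau>_def algebra_simps)
    have ev: "eventually (\<lambda>N. u N / N = \<bar>(1 - 2 * \<gamma>) * (real (k N) * ln N / N) + real (k N) * ln (1 + (inverse (\<epsilon> N))\<^sup>2) / N + (\<epsilon> N)\<^sup>2
        + ((2 * \<gamma> - 1) * (ln N / N) + ln 2 * (1 / N) + 2 * (ln (max 1 (sing_val (A N) 1)) / N)) - 2 * \<tau>\<bar>) sequentially"
      using eventually_ge_at_top[of 1]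
    proof eventually_elim
      case (elim N)
      then have "u N / N = \<bar>(real (k N) * ((1 - 2 * \<gamma>) * ln N) + real (k N) * ln (1 + (inverse (\<epsilon> N))\<^sup>2) + N * (\<epsilon> N)\<^sup>2
        + ((2 * \<gamma> - 1) * ln N + ln 2 + 2 * ln (max 1 (sing_val (A N) 1))) - 2 * (N * \<tau>)) / N\<bar>"
        by (simp add: u_def)
      also have "(real (k N) * ((1 - 2 * \<gamma>) * ln N) + real (k N) * ln (1 + (inverse (\<epsilon> N))\<^sup>2) + N * (\<epsilon> N)\<^sup>2
        + ((2 * \<gamma> - 1) * ln N + ln 2 + 2 * ln (max 1 (sing_val (A N) 1))) - 2 * (N * \<tau>)) / N
        = (1 - 2 * \<gamma>) * (real (k N) * ln N / N) + real (k N) * ln (1 + (inverse (\<epsilon> N))\<^sup>2) / N + (\<epsilon> N)\<^sup>2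
        + ((2 * \<gamma> - 1) * (ln N / N) + ln 2 * (1 / N) + 2 * (ln (max 1 (sing_val (A N) 1)) / N)) - 2 * \<tau>"
        using elim by (simp add: add_divide_distrib diff_divide_distrib mult_ac)
      finally show ?case .
    qed
    show ?thesis using tendsto_cong[OF ev, of 0] lim by (simp only: zero abs_zero)
  qed
  have l0: "(\<lambda>N. l N / N) \<longlonglongrightarrow> 0"
  proof -
    have lim: "(\<lambda>N. \<bar>2 * \<tau> + 2 * \<gamma> * (real (k N) * ln N / N) - (real (k N) * ln N / N - 2 * sqrt (real (k N) / N) - k N / N)\<bar>)
      \<longlonglongrightarrow> \<bar>2 * \<tau> + 2 * \<gamma> * \<alpha> - (\<alpha> - 2 * sqrt 0 - 0)\<bar>"
      by (intro tendsto_rabs tendsto_diff tendsto_add tendsto_mult tendsto_const tendsto_real_sqrt kl kN)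
    have zero: "2 * \<tau> + 2 * \<gamma> * \<alpha> - (\<alpha> - 2 * sqrt 0 - 0) = 0" by (simp add: \<tau>_def algebra_simps)
    have ev: "eventually (\<lambda>N. l N / N = \<bar>2 * \<tau> + 2 * \<gamma> * (real (k N) * ln N / N) - (real (k N) * ln N / N - 2 * sqrt (real (k N) / N) - k N / N)\<bar>) sequentially"
      using eventually_ge_at_top[of 1]
    proof eventually_elim
      case (elim N)
      then have "l N / N = \<bar>(2 * (N * \<tau>) + 2 * \<gamma> * (real (k N) * ln N)
        - (real (k N) * ln N - 2 * real N * sqrt (real (k N) / N) - k N)) / N\<bar>"
        by (simp add: l_def)
      also have "(2 * (N * \<tau>) + 2 * \<gamma> * (real (k N) * ln N) - (real (k N) * ln N - 2 * real N * sqrt (real (k N) / N) - k N)) / N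
        = 2 * \<tau> + 2 * \<gamma> * (real (k N) * ln N / N) - (real (k N) * ln N / N - 2 * sqrt (real (k N) / N) - k N / N)"
        using elim by (simp add: add_divide_distrib diff_divide_distrib)
      finally show ?case .
    qed
    show ?thesis using tendsto_cong[OF ev, of 0] lim by (simp only: zero abs_zero)
  qed
  let ?E = "\<lambda>N. {\<omega> \<in> space (P N). d < \<bar>1 / real N * ln (cmod (Determinant.det
               (Sigma_mat (shifted (M N) z) + complex_of_real (real N powr (- \<gamma>)) \<cdot>\<^sub>m G N \<omega>)))
           - 1 / real N * ln (cmod (Determinant.det (B_mat \<gamma> (\<epsilon> N) (shifted (M N) z)))) - - \<alpha> * (\<gamma> - 1 / 2)\<bar>}"
  let ?R = "\<lambda>N. (2 * (u N / N) + l N / N + 2 * shift_loss * (k N / N) + 4 * (1 / N)) / (2 * d - 1 / N)"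
  show "(\<lambda>N. measure (P N) (?E N)) \<longlonglongrightarrow> 0"
  proof (rule tendsto_sandwich)
    show "eventually (\<lambda>N. 0 \<le> measure (P N) (?E N)) sequentially" by simp
    have "(\<lambda>N. 2 * d - 1 / real N) \<longlonglongrightarrow> 2 * d - 0"
      by (intro tendsto_diff tendsto_const lim_1_over_n)
    from order_tendstoD(1)[OF this, of 0] d
    have "eventually (\<lambda>N. 2 * d - 1 / real N > 0) sequentially" by simp
    then show "eventually (\<lambda>N. measure (P N) (?E N) \<le> ?R N) sequentially"
      using \<epsilon>pos eventually_ge_at_top[of 1]
    proof eventually_elim
      case (elim N)
      then have N: "real N > 0" by simp
      have r: "real N * d > 1/2" using elim(1) N by (simp add: field_simps)
      have E: "?E N = {\<omega> \<in> space (P N). \<bar>ln (cmod (Determinant.det (Sigma_mat (A N) + complex_of_real (real N powr (- \<gamma>)) \<cdot>\<^sub>m G N \<omega>)))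
        - (ln (cmod (Determinant.det (B_mat \<gamma> (\<epsilon> N) (A N)))) + N * \<tau>)\<bar> > real N * d}"
      proof -
        have "d < \<bar>1 / real N * x - 1 / real N * y - \<tau>\<bar> \<longleftrightarrow> \<bar>x - (y + N * \<tau>)\<bar> > real N * d" for x y
        proof -
          have "1 / real N * x - 1 / real N * y - \<tau> = (x - (y + N * \<tau>)) / N" using N by (simp add: field_simps)
          then have "\<bar>1 / real N * x - 1 / real N * y - \<tau>\<bar> = \<bar>x - (y + N * \<tau>)\<bar> / N" by simp
          then show ?thesis using N by (simp add: pos_less_divide_eq mult.commute)
        qed
        then show ?thesis unfolding \<tau>_def[symmetric] A_def[symmetric] by blast
      qed
      have "measure (P N) (?E N) \<le> (2 * u N + l N + 2 * (real (k N) * shift_loss) + 4) / (2 * (real N * d) - 1)"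
        unfolding E k_def
      proof (rule det_deviation)
        show "A N \<in> carrier_mat N N" using A elim by blast
        show "iid_gaussian_matrix (P N) N (G N)" using assms(3) elim by blast
        show "real (N_star \<gamma> (\<epsilon> N) (A N)) * ((1 - 2 * \<gamma>) * ln (real N)) + real (N_star \<gamma> (\<epsilon> N) (A N)) * ln (1 + (inverse (\<epsilon> N))\<^sup>2)
          + real N * (\<epsilon> N)\<^sup>2 + ((2 * \<gamma> - 1) * ln (real N) + ln 2 + 2 * ln (max 1 (sing_val (A N) 1))) - 2 * (real N * \<tau>) \<le> u N"
          unfolding u_def k_def by (rule abs_ge_self)
        show "2 * (real N * \<tau>) + 2 * \<gamma> * (real (N_star \<gamma> (\<epsilon> N) (A N)) * ln (real N)) -
          (real (N_star \<gamma> (\<epsilon> N) (A N)) * ln (real N) - 2 * real N * sqrt (real (N_star \<gamma> (\<epsilon> N) (A N)) / real N) - real (N_star \<gamma> (\<epsilon> N) (A N))) \<le> l N"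
          unfolding l_def k_def by (rule abs_ge_self)
      qed (use elim assms(1) r in \<open>auto simp: u_def l_def\<close>)
      also have "\<dots> = ((2 * u N + l N + 2 * (real (k N) * shift_loss) + 4) / N) / ((2 * (real N * d) - 1) / N)"
        using N by simp
      also have "\<dots> = ?R N"
        using N by (simp add: add_divide_distrib diff_divide_distrib mult_ac)
      finally show ?case .
    qed
    have "?R \<longlonglongrightarrow> (2 * 0 + 0 + 2 * shift_loss * 0 + 4 * 0) / (2 * d - 0)"
      using d by (intro tendsto_divide tendsto_diff tendsto_add tendsto_mult tendsto_const u0 l0 kN lim_1_over_n) auto
    then show "?R \<longlonglongrightarrow> 0" by simp
  qed simp
qed

end
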